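(* If a computable rigid structure $\mathcal A$ is relatively $\mathbf x$-computably categorical for some $1$-generic Turing degree $\mathbf x$, then $\mathcal A$ is relatively computably categorical.
   Context: Computable structures have domain $\omega$, a computable (possibly infinite) language, and a computable atomic diagram. A structure is rigid if it has no nontrivial automorphisms. For a Turing degree $\mathbf x$, a computable structure $\mathcal A$ is relatively $\mathbf x$-computably categorical if for every isomorphic copy $\mathcal B\cong\mathcal A$ (with domain $\omega$) there is a $(\deg(\mathcal B)\cup\mathbf x)$-computable isomorphism from $\mathcal B$ onto $\mathcal A$, where $\deg(\mathcal B)$ is the Turing degree of the atomic diagram of $\mathcal B$ and $\cup$ denotes the join of Turing degrees. Relatively computably categorical means relatively $\mathbf 0$-computably categorical, where $\mathbf 0$ is the degree of computable sets. A Turing degree $\mathbf x$ is $1$-generic if it contains a set $X$ such that for every c.e. set $W\subseteq 2^{<\omega}$ there is a finite initial segment $\sigma\subset X$ with $\sigma\in W$ or $(\forall\tau\supseteq\sigma)[\tau\notin W]$. *)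

theory Defs
  imports "HOL-Library.Nat_Bijection" "HOL-Library.Sublist"
begin

section \<open>Relative computability\<close>

text \<open>
  Programs for partial recursive functions relative to a set \<open>X\<close> of natural numbers. \<open>Query\<close>
  answers membership in \<open>X\<close>; \<open>Rec f g\<close> recurses on the first argument, and \<open>Mu f\<close> searches for
  the least first argument at which \<open>f\<close> vanishes.
\<close>

datatype prog =
    Zero
  | Succ
  | Proj nat
  | Query
  | Comp prog "prog list"
  | Rec prog prog
  | Mu prog

text \<open>\<open>yields X e xs y\<close>: program \<open>e\<close> relative to \<open>X\<close> halts on input \<open>xs\<close> with output \<open>y\<close>.\<close>

inductive yields :: "nat set \<Rightarrow> prog \<Rightarrow> nat list \<Rightarrow> nat \<Rightarrow> bool" for X where
  Zero: "yields X Zero xs 0"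
| Succ: "yields X Succ (x # xs) (Suc x)"
| Proj: "i < length xs \<Longrightarrow> yields X (Proj i) xs (xs ! i)"
| Query: "yields X Query (x # xs) (of_bool (x \<in> X))"
| Comp: "list_all2 (\<lambda>g y. yields X g xs y) gs ys \<Longrightarrow> yields X f ys z \<Longrightarrow>
    yields X (Comp f gs) xs z"
| Rec_0: "yields X f xs y \<Longrightarrow> yields X (Rec f g) (0 # xs) y"
| Rec_Suc: "yields X (Rec f g) (n # xs) y \<Longrightarrow> yields X g (n # y # xs) z \<Longrightarrow>
    yields X (Rec f g) (Suc n # xs) z"
| Mu: "yields X f (n # xs) 0 \<Longrightarrow> (\<And>m. m < n \<Longrightarrow> \<exists>y. yields X f (m # xs) (Suc y)) \<Longrightarrow>
    yields X (Mu f) xs n"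

inductive_cases Zero_E: "yields X Zero xs y"
inductive_cases Succ_E: "yields X Succ xs y"
inductive_cases Proj_E: "yields X (Proj i) xs y"
inductive_cases Query_E: "yields X Query xs y"
inductive_cases Comp_E: "yields X (Comp f gs) xs y"
inductive_cases Rec_E: "yields X (Rec f g) xs y"
inductive_cases Mu_E: "yields X (Mu f) xs y"

lemma yields_deterministic: "yields X e xs y \<Longrightarrow> yields X e xs z \<Longrightarrow> y = z"
proof (induction arbitrary: z rule: yields.induct)
  case (Comp xs gs ys f y)
  from Comp.prems obtain zs where zs: "list_all2 (\<lambda>g y. yields X g xs y) gs zs" "yields X f zs z"
    by (auto elim: Comp_E)
  have "ys = zs"
    using Comp.hyps(1) Comp.IH(1) zs(1)
    by (auto simp: list_all2_conv_all_nth intro: nth_equalityI)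
  then show ?case using Comp.IH zs(2) by blast
next
  case (Rec_Suc f g n xs y w)
  from Rec_Suc.prems obtain y' where "yields X (Rec f g) (n # xs) y'" "yields X g (n # y' # xs) z"
    by (rule Rec_E) auto
  then show ?case using Rec_Suc.IH by metis
next
  case (Rec_0 f xs y g)
  from Rec_0.prems have "yields X f xs z" by (rule Rec_E) auto
  then show ?case by (rule Rec_0.IH)
next
  case (Mu f n xs)
  from Mu.prems have z: "yields X f (z # xs) 0"
    and zmin: "\<And>m. m < z \<Longrightarrow> \<exists>y. yields X f (m # xs) (Suc y)"
    by (auto elim: Mu_E)
  show ?case
  proof (cases n z rule: linorder_cases)
    case less
    then show ?thesis using zmin[OF less] Mu.IH(1) by fastforce
  next
    case greater
    then show ?thesis using Mu.IH(2)[OF greater] z by fastforce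
  qed
qed (auto elim: Zero_E Succ_E Proj_E Query_E)

definition computable_from :: "nat set \<Rightarrow> (nat \<Rightarrow> nat) \<Rightarrow> bool" where
  "computable_from X f \<longleftrightarrow> (\<exists>e. \<forall>n. yields X e [n] (f n))"

definition turing_reducible :: "nat set \<Rightarrow> nat set \<Rightarrow> bool" where
  "turing_reducible Y X \<longleftrightarrow> computable_from X (\<lambda>n. of_bool (n \<in> Y))"

definition decidable :: "nat set \<Rightarrow> bool" where
  "decidable S \<longleftrightarrow> turing_reducible S {}"

definition ce :: "nat set \<Rightarrow> bool" where
  "ce S \<longleftrightarrow> (\<exists>e. \<forall>n. n \<in> S \<longleftrightarrow> (\<exists>y. yields {} e [n] y))"

text \<open>Replacing queries to \<open>Y\<close> by calls of a program that decides \<open>Y\<close>.\<close>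

primrec subst_query :: "prog \<Rightarrow> prog \<Rightarrow> prog" where
  "subst_query p Zero = Zero"
| "subst_query p Succ = Succ"
| "subst_query p (Proj i) = Proj i"
| "subst_query p Query = Comp p [Proj 0]"
| "subst_query p (Comp f gs) = Comp (subst_query p f) (map (subst_query p) gs)"
| "subst_query p (Rec f g) = Rec (subst_query p f) (subst_query p g)"
| "subst_query p (Mu f) = Mu (subst_query p f)"

lemma yields_Proj_0: "yields X (Proj 0) (x # xs) x"
  using yields.Proj[of 0 "x # xs"] by simp

lemma yields_Comp1: "yields X g xs y \<Longrightarrow> yields X f [y] z \<Longrightarrow> yields X (Comp f [g]) xs z"
  by (rule yields.Comp[of X xs "[g]" "[y]"]) auto

lemma yields_Comp2:
  "yields X g xs y \<Longrightarrow> yields X g' xs y' \<Longrightarrow> yields X f [y, y'] z \<Longrightarrow> yields X (Comp f [g, g']) xs z"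
  by (rule yields.Comp[of X xs "[g, g']" "[y, y']"]) auto

lemma yields_Comp3:
  "yields X g xs y \<Longrightarrow> yields X g' xs y' \<Longrightarrow> yields X g'' xs y'' \<Longrightarrow> yields X f [y, y', y''] z \<Longrightarrow>
    yields X (Comp f [g, g', g'']) xs z"
  by (rule yields.Comp[of X xs "[g, g', g'']" "[y, y', y'']"]) auto

lemma yields_subst_query:
  assumes p: "\<And>n. yields X p [n] (of_bool (n \<in> Y))"
  shows "yields Y e xs y \<Longrightarrow> yields X (subst_query p e) xs y"
proof (induction rule: yields.induct)
  case (Query x xs)
  show ?case using yields_Comp1[OF yields_Proj_0 p] by simp
next
  case (Comp xs gs ys f z)
  then show ?case
    by (auto intro!: yields.Comp[where ys = ys] simp: list_all2_conv_all_nth)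
next
  case (Mu f n xs)
  have "\<exists>y. yields X (subst_query p f) (m # xs) (Suc y)" if "m < n" for m
    using Mu.IH(2)[OF that] by blast
  then show ?case using yields.Mu[OF Mu.IH(1)] by simp
qed (auto intro: yields.intros)

lemma turing_reducibleI:
  "(\<And>n. yields X e [n] (of_bool (n \<in> Y))) \<Longrightarrow> turing_reducible Y X"
  unfolding turing_reducible_def computable_from_def by blast

lemma computable_from_trans:
  assumes "computable_from Y f" "turing_reducible Y X"
  shows "computable_from X f"
  using assms yields_subst_query unfolding computable_from_def turing_reducible_def by metis

lemma turing_reducible_trans:
  "turing_reducible Z Y \<Longrightarrow> turing_reducible Y X \<Longrightarrow> turing_reducible Z X"
  using computable_from_trans unfolding turing_reducible_def by blast

lemma turing_reducible_refl: "turing_reducible X X"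
  unfolding turing_reducible_def computable_from_def by (blast intro: yields.Query)

lemma turing_reducible_empty: "turing_reducible {} X"
  unfolding turing_reducible_def computable_from_def by (auto intro: yields.Zero)

definition turing_join :: "nat set \<Rightarrow> nat set \<Rightarrow> nat set" where
  "turing_join X Y = {2 * n |n. n \<in> X} \<union> {2 * n + 1 |n. n \<in> Y}"

lemma turing_join_iff: "2 * n \<in> turing_join X Y \<longleftrightarrow> n \<in> X" "Suc (2 * n) \<in> turing_join X Y \<longleftrightarrow> n \<in> Y"
  unfolding turing_join_def by (auto dest: arg_cong[where f = even])

context
begin

private definition "pAdd = Rec (Proj 0) (Comp Succ [Proj 1])"
private definition "pNot = Rec (Comp Succ [Zero]) Zero"
private definition "pPar = Rec Zero (Comp pNot [Proj 1])"
private definition "pHalf = Rec Zero (Comp pAdd [Comp pPar [Proj 0], Proj 1])"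
private definition "pCond = Rec (Proj 0) (Proj 3)"

private lemma proj:
  "yields X (Proj 0) (a # xs) a" "yields X (Proj 1) (a # b # xs) b"
  "yields X (Proj 3) (a # b # c # d # xs) d"
  using yields.Proj[of 0 "a # xs"] yields.Proj[of 1 "a # b # xs"]
    yields.Proj[of 3 "a # b # c # d # xs"] by (auto simp: numeral_3_eq_3)

private lemma pAdd: "yields X pAdd [n, m] (n + m)"
  unfolding pAdd_def
proof (induction n)
  case (Suc n)
  then show ?case
    using yields.Rec_Suc[OF Suc yields_Comp1[OF proj(2) yields.Succ]] by simp
qed (auto intro: yields.Rec_0 proj)

private lemma pNot: "yields X pNot [n] (of_bool (n = 0))"
  unfolding pNot_def
proof (induction n)
  case 0
  show ?case
    using yields.Rec_0[OF yields_Comp1[OF yields.Zero yields.Succ]] by simp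
next
  case (Suc n)
  show ?case using yields.Rec_Suc[OF Suc yields.Zero] by simp
qed

private lemma pPar: "yields X pPar [n] (n mod 2)"
  unfolding pPar_def
proof (induction n)
  case (Suc n)
  have "of_bool (n mod 2 = 0) = Suc n mod 2" by (simp add: mod_Suc)
  then show ?case
    using yields.Rec_Suc[OF Suc yields_Comp1[OF proj(2) pNot]] by simp
qed (auto intro: yields.Rec_0 yields.Zero)

private lemma pHalf: "yields X pHalf [n] (n div 2)"
  unfolding pHalf_def
proof (induction n)
  case (Suc n)
  have "n mod 2 + n div 2 = Suc n div 2" by presburger
  then show ?case
    using yields.Rec_Suc[OF Suc yields_Comp2[OF yields_Comp1[OF proj(1) pPar] proj(2) pAdd]]
    by simp
qed (auto intro: yields.Rec_0 yields.Zero)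

private lemma pCond: "yields X pCond [n, a, b] (if n = 0 then a else b)"
  unfolding pCond_def
proof (induction n)
  case (Suc n)
  show ?case using yields.Rec_Suc[OF Suc proj(3)] by simp
qed (auto intro: yields.Rec_0 proj)

lemma turing_join_upper:
  "turing_reducible X (turing_join X Y)" "turing_reducible Y (turing_join X Y)"
proof -
  let ?J = "turing_join X Y"
  have "yields ?J (Comp Query [Comp pAdd [Proj 0, Proj 0]]) [n] (of_bool (n + n \<in> ?J))" for n
    by (rule yields_Comp1[OF yields_Comp2[OF proj(1) proj(1) pAdd] yields.Query])
  moreover have "n + n \<in> ?J \<longleftrightarrow> n \<in> X" for n
    by (simp add: turing_join_iff flip: mult_2)
  ultimately show "turing_reducible X ?J"
    by (intro turing_reducibleI) (simp only:)
  have "yields ?J (Comp Query [Comp Succ [Comp pAdd [Proj 0, Proj 0]]]) [n]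
      (of_bool (Suc (n + n) \<in> ?J))" for n
    by (rule yields_Comp1[OF yields_Comp1[OF yields_Comp2[OF proj(1) proj(1) pAdd] yields.Succ]
          yields.Query])
  moreover have "Suc (n + n) \<in> ?J \<longleftrightarrow> n \<in> Y" for n
    by (simp add: turing_join_iff flip: mult_2)
  ultimately show "turing_reducible Y ?J"
    by (intro turing_reducibleI) (simp only:)
qed

lemma turing_join_least:
  assumes "turing_reducible X Z" "turing_reducible Y Z"
  shows "turing_reducible (turing_join X Y) Z"
proof -
  obtain p q where p: "\<And>n. yields Z p [n] (of_bool (n \<in> X))"
    and q: "\<And>n. yields Z q [n] (of_bool (n \<in> Y))"
    using assms unfolding turing_reducible_def computable_from_def by blast
  let ?half = "Comp pHalf [Proj 0]"
  let ?e = "Comp pCond [Comp pPar [Proj 0], Comp p [?half], Comp q [?half]]"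
  have "yields Z ?e [n] (if n mod 2 = 0 then of_bool (n div 2 \<in> X) else of_bool (n div 2 \<in> Y))" for n
    by (rule yields_Comp3[OF yields_Comp1[OF proj(1) pPar]
          yields_Comp1[OF yields_Comp1[OF proj(1) pHalf] p]
          yields_Comp1[OF yields_Comp1[OF proj(1) pHalf] q] pCond])
  moreover have "(if n mod 2 = 0 then of_bool (n div 2 \<in> X) else of_bool (n div 2 \<in> Y)) =
      (of_bool (n \<in> turing_join X Y) :: nat)" for n
    by (cases "even n") (auto simp: turing_join_iff elim!: evenE oddE)
  ultimately show ?thesis
    by (intro turing_reducibleI) (simp only:)
qed

end


section \<open>Turing degrees\<close>

definition turing_equivalent :: "nat set \<Rightarrow> nat set \<Rightarrow> bool" where
  "turing_equivalent X Y \<longleftrightarrow> turing_reducible X Y \<and> turing_reducible Y X"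

quotient_type turing_degree = "nat set" / turing_equivalent
  morphisms degree_rep degree
  unfolding turing_equivalent_def
  by (rule equivpI)
    (auto simp: reflp_def symp_def transp_def
      intro: turing_reducible_refl turing_reducible_trans)

instantiation turing_degree :: bounded_semilattice_sup_bot
begin

lift_definition less_eq_turing_degree :: "turing_degree \<Rightarrow> turing_degree \<Rightarrow> bool"
  is turing_reducible
  unfolding turing_equivalent_def by (blast intro: turing_reducible_trans)

definition less_turing_degree :: "turing_degree \<Rightarrow> turing_degree \<Rightarrow> bool" where
  "less_turing_degree x y \<longleftrightarrow> x \<le> y \<and> \<not> y \<le> x"

lift_definition sup_turing_degree :: "turing_degree \<Rightarrow> turing_degree \<Rightarrow> turing_degree"
  is turing_join
  unfolding turing_equivalent_def
  by (blast intro: turing_join_least turing_join_upper turing_reducible_trans)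

lift_definition bot_turing_degree :: turing_degree is "{}" .

instance
proof
  fix x y z :: turing_degree
  show "x < y \<longleftrightarrow> x \<le> y \<and> \<not> y \<le> x" by (rule less_turing_degree_def)
  show "x \<le> x" by transfer (rule turing_reducible_refl)
  show "x \<le> y \<Longrightarrow> y \<le> z \<Longrightarrow> x \<le> z" by transfer (rule turing_reducible_trans)
  show "x \<le> y \<Longrightarrow> y \<le> x \<Longrightarrow> x = y" by transfer (simp add: turing_equivalent_def)
  show "x \<le> sup x y" "y \<le> sup x y" by (transfer, rule turing_join_upper)+
  show "y \<le> x \<Longrightarrow> z \<le> x \<Longrightarrow> sup y z \<le> x" by transfer (rule turing_join_least)
  show "bot \<le> x" by transfer (rule turing_reducible_empty)
qed

end

lift_definition degree_computes :: "turing_degree \<Rightarrow> (nat \<Rightarrow> nat) \<Rightarrow> bool"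
  is computable_from
  unfolding turing_equivalent_def by (blast intro: computable_from_trans)


section \<open>Genericity\<close>

text \<open>
  A finite binary string is a \<open>bool list\<close>, numbered by \<open>string_code\<close>; it is an initial segment
  of \<open>X\<close> if it agrees with the characteristic function of \<open>X\<close> on its domain.
\<close>

definition string_code :: "bool list \<Rightarrow> nat" where
  "string_code \<sigma> = list_encode (map of_bool \<sigma>)"

definition ce_strings :: "bool list set \<Rightarrow> bool" where
  "ce_strings W \<longleftrightarrow> ce (string_code ` W)"

definition initial_segment :: "bool list \<Rightarrow> nat set \<Rightarrow> bool" where
  "initial_segment \<sigma> X \<longleftrightarrow> (\<forall>i < length \<sigma>. \<sigma> ! i \<longleftrightarrow> i \<in> X)"

definition one_generic :: "nat set \<Rightarrow> bool" where
  "one_generic X \<longleftrightarrow> (\<forall>W. ce_strings W \<longrightarrow>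
    (\<exists>\<sigma>. initial_segment \<sigma> X \<and> (\<sigma> \<in> W \<or> (\<forall>\<tau>. prefix \<sigma> \<tau> \<longrightarrow> \<tau> \<notin> W))))"

definition one_generic_degree :: "turing_degree \<Rightarrow> bool" where
  "one_generic_degree x \<longleftrightarrow> (\<exists>X. x = degree X \<and> one_generic X)"


section \<open>Structures with domain \<open>\<omega>\<close>\<close>

text \<open>
  Symbols are natural numbers; relation and function symbols are numbered separately. Arities are
  only meaningful on the symbols of the language, and constants are function symbols of arity 0.
\<close>

record language =
  rel_symbols :: "nat set"
  rel_arity :: "nat \<Rightarrow> nat"
  fun_symbols :: "nat set"
  fun_arity :: "nat \<Rightarrow> nat"

definition computable_language :: "language \<Rightarrow> bool" where
  "computable_language L \<longleftrightarrow>
    decidable (rel_symbols L) \<and> decidable (fun_symbols L) \<and>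
    (\<exists>e. \<forall>r \<in> rel_symbols L. yields {} e [r] (rel_arity L r)) \<and>
    (\<exists>e. \<forall>f \<in> fun_symbols L. yields {} e [f] (fun_arity L f))"

text \<open>
  The domain is the whole type \<open>nat\<close>. Values of the interpretation at non-symbols or at argument
  lists of the wrong length are irrelevant and are ignored by all notions below.
\<close>

record model =
  rel_interp :: "nat \<Rightarrow> nat list \<Rightarrow> bool"
  fun_interp :: "nat \<Rightarrow> nat list \<Rightarrow> nat"

definition isomorphism :: "language \<Rightarrow> model \<Rightarrow> model \<Rightarrow> (nat \<Rightarrow> nat) \<Rightarrow> bool" where
  "isomorphism L B A h \<longleftrightarrow> bij h \<and>
    (\<forall>r \<in> rel_symbols L. \<forall>xs. length xs = rel_arity L r \<longrightarrow>
      (rel_interp B r xs \<longleftrightarrow> rel_interp A r (map h xs))) \<and>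
    (\<forall>f \<in> fun_symbols L. \<forall>xs. length xs = fun_arity L f \<longrightarrow>
      h (fun_interp B f xs) = fun_interp A f (map h xs))"

definition isomorphic :: "language \<Rightarrow> model \<Rightarrow> model \<Rightarrow> bool" where
  "isomorphic L B A \<longleftrightarrow> (\<exists>h. isomorphism L B A h)"

definition rigid :: "language \<Rightarrow> model \<Rightarrow> bool" where
  "rigid L A \<longleftrightarrow> (\<forall>h. isomorphism L A A h \<longrightarrow> h = id)"


subsection \<open>Atomic diagrams\<close>

text \<open>
  Closed terms, atomic sentences and literals in the language expanded by a constant \<open>Elem n\<close>
  naming each element \<open>n\<close> of the domain. The atomic diagram consists of the true atomic and
  negated atomic sentences, identified with their code numbers.
\<close>

datatype closed_term = Elem nat | App nat "closed_term list"
datatype atom = Eq closed_term closed_term | Rel nat "closed_term list"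
datatype literal = Pos atom | Neg atom

primrec wf_term :: "language \<Rightarrow> closed_term \<Rightarrow> bool" where
  "wf_term L (Elem n) \<longleftrightarrow> True"
| "wf_term L (App f ts) \<longleftrightarrow>
    f \<in> fun_symbols L \<and> length ts = fun_arity L f \<and> list_all (wf_term L) ts"

primrec wf_atom :: "language \<Rightarrow> atom \<Rightarrow> bool" where
  "wf_atom L (Eq s t) \<longleftrightarrow> wf_term L s \<and> wf_term L t"
| "wf_atom L (Rel r ts) \<longleftrightarrow>
    r \<in> rel_symbols L \<and> length ts = rel_arity L r \<and> list_all (wf_term L) ts"

primrec wf_literal :: "language \<Rightarrow> literal \<Rightarrow> bool" where
  "wf_literal L (Pos a) \<longleftrightarrow> wf_atom L a"
| "wf_literal L (Neg a) \<longleftrightarrow> wf_atom L a"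

primrec term_value :: "model \<Rightarrow> closed_term \<Rightarrow> nat" where
  "term_value A (Elem n) = n"
| "term_value A (App f ts) = fun_interp A f (map (term_value A) ts)"

primrec atom_true :: "model \<Rightarrow> atom \<Rightarrow> bool" where
  "atom_true A (Eq s t) \<longleftrightarrow> term_value A s = term_value A t"
| "atom_true A (Rel r ts) \<longleftrightarrow> rel_interp A r (map (term_value A) ts)"

primrec literal_true :: "model \<Rightarrow> literal \<Rightarrow> bool" where
  "literal_true A (Pos a) \<longleftrightarrow> atom_true A a"
| "literal_true A (Neg a) \<longleftrightarrow> \<not> atom_true A a"

primrec term_code :: "closed_term \<Rightarrow> nat" where
  "term_code (Elem n) = list_encode [0, n]"
| "term_code (App f ts) = list_encode (1 # f # map term_code ts)"

primrec atom_code :: "atom \<Rightarrow> nat" where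
  "atom_code (Eq s t) = list_encode [0, term_code s, term_code t]"
| "atom_code (Rel r ts) = list_encode (1 # r # map term_code ts)"

primrec literal_code :: "literal \<Rightarrow> nat" where
  "literal_code (Pos a) = list_encode [0, atom_code a]"
| "literal_code (Neg a) = list_encode [1, atom_code a]"

lemma term_code_inject: "term_code s = term_code t \<longleftrightarrow> s = t"
proof (induction s arbitrary: t)
  case (Elem n)
  then show ?case by (cases t) (auto simp: list_encode_eq simp del: list_encode.simps)
next
  case (App f ts)
  have *: "map term_code ts = map term_code us \<longleftrightarrow> ts = us" for us
    using App by (auto simp: list_eq_iff_nth_eq)
  show ?case by (cases t) (auto simp: list_encode_eq * simp del: list_encode.simps)
qed

lemma literal_code_inject: "literal_code l = literal_code m \<longleftrightarrow> l = m"
proof -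
  have *: "map term_code ts = map term_code us \<longleftrightarrow> ts = us" for ts us
    by (auto simp: list_eq_iff_nth_eq term_code_inject)
  have **: "atom_code a = atom_code b \<longleftrightarrow> a = b" for a b
    by (cases a; cases b) (auto simp: list_encode_eq * term_code_inject simp del: list_encode.simps)
  show ?thesis
    by (cases l; cases m) (auto simp: list_encode_eq ** simp del: list_encode.simps)
qed

definition atomic_diagram :: "language \<Rightarrow> model \<Rightarrow> nat set" where
  "atomic_diagram L A = literal_code ` {l. wf_literal L l \<and> literal_true A l}"

definition model_degree :: "language \<Rightarrow> model \<Rightarrow> turing_degree" where
  "model_degree L A = degree (atomic_diagram L A)"

definition computable_structure :: "language \<Rightarrow> model \<Rightarrow> bool" where
  "computable_structure L A \<longleftrightarrow> computable_language L \<and> decidable (atomic_diagram L A)"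


section \<open>Relative computable categoricity\<close>

definition relatively_categorical :: "turing_degree \<Rightarrow> language \<Rightarrow> model \<Rightarrow> bool" where
  "relatively_categorical x L A \<longleftrightarrow>
    (\<forall>B. isomorphic L B A \<longrightarrow>
      (\<exists>h. isomorphism L B A h \<and> degree_computes (sup (model_degree L B) x) h))"

definition relatively_computably_categorical :: "language \<Rightarrow> model \<Rightarrow> bool" where
  "relatively_computably_categorical L A \<longleftrightarrow> relatively_categorical bot L A"

end

(*
  Let X be the given 1-generic set. A finite injection q (a distinct
  list, mapping i to q ! i) and a finite string tau decide finitely many queries to the join of X
  with the diagram of a copy G of A that has an isomorphism onto A extending q. For a program e and
  a finite injection p, the strings tau with which some extension of p makes e converge to a wrong
  value of this isomorphism form a c.e. set. So by 1-genericity, either an initial segment of X is in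
  this set, and p has an extension forcing e to be wrong, or some initial segment sigma of X has no
  extension in it. If in the second case some extension of p, together with X, prevented e from
  converging, then e could be forced to fail in both cases. If that happened for all e and p, one
  could build a copy G whose isomorphism onto A, unique by rigidity, is not computable from X joined
  with the diagram of G. Hence for some e, p and sigma no extension of p and sigma yields a wrong
  value, while every extension of p can be extended to make e converge. Now let f be an isomorphism
  from a copy B onto A and pull p back along f. Then f b is the output of any convergent computation
  from an extension of this pulled back injection that contains b and a string extending sigma; the
  search needs no access to X because all such strings give the right answer.
*)

theory Submission
  imports Defs "HOL-Library.Countable"
begin

section \<open>Computable functions on coded data\<close>

class coded =
  fixes encode :: "'a \<Rightarrow> nat"

instantiation nat :: coded
begin
definition encode_nat :: "nat \<Rightarrow> nat" where [simp]: "encode_nat n = n"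
instance ..
end

instantiation bool :: coded
begin
definition encode_bool :: "bool \<Rightarrow> nat" where [simp]: "encode_bool b = of_bool b"
instance ..
end

instantiation prod :: (coded, coded) coded
begin
definition encode_prod :: "'a \<times> 'b \<Rightarrow> nat" where
  [simp]: "encode_prod p = prod_encode (encode (fst p), encode (snd p))"
instance ..
end

instantiation list :: (coded) coded
begin
definition encode_list :: "'a list \<Rightarrow> nat" where
  [simp]: "encode_list xs = list_encode (map encode xs)"
instance ..
end

text \<open>\<open>None\<close> gets code 0 and \<open>Some\<close> a successor, just as
  \<open>[]\<close> and \<open>#\<close> do under \<open>list_encode\<close>. Hence each case
  distinction on numbers, options or lists is a zero test followed by a predecessor.\<close>

instantiation option :: (coded) coded
begin
definition encode_option :: "'a option \<Rightarrow> nat" where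
  [simp]: "encode_option x = (case x of None \<Rightarrow> 0 | Some a \<Rightarrow> Suc (encode a))"
instance ..
end

lemma map_encode_nat [simp]: "map encode (xs :: nat list) = xs"
  by (induction xs) auto

text \<open>Programs act on codes and are constrained on codes only; their behaviour on other
  numbers is left open.\<close>

definition rec_in :: "nat set \<Rightarrow> ('a::coded \<Rightarrow> 'b::coded) \<Rightarrow> bool" where
  "rec_in X f \<longleftrightarrow> (\<exists>e. \<forall>a. yields X e [encode a] (encode (f a)))"

lemma rec_inI: "(\<And>a. yields X e [encode a] (encode (f a))) \<Longrightarrow> rec_in X f"
  unfolding rec_in_def by blast

lemma rec_in_nat_iff: "rec_in X (f :: nat \<Rightarrow> nat) \<longleftrightarrow> computable_from X f"
  by (simp add: rec_in_def computable_from_def)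

lemma rec_in_member_iff: "rec_in X (\<lambda>n. n \<in> Y) \<longleftrightarrow> turing_reducible Y X"
  by (simp add: rec_in_def turing_reducible_def computable_from_def)

lemma yields_Projs:
  "yields X (Proj 0) (a # xs) a" "yields X (Proj 1) (a # b # xs) b"
  "yields X (Proj 2) (a # b # c # xs) c" "yields X (Proj 3) (a # b # c # d # xs) d"
  using yields.Proj[of 0 "a # xs"] yields.Proj[of 1 "a # b # xs"]
    yields.Proj[of 2 "a # b # c # xs"] yields.Proj[of 3 "a # b # c # d # xs"]
  by (auto simp: numeral_3_eq_3 numeral_2_eq_2)

section \<open>Programs for arithmetic, pairing and branching\<close>

context
begin

private definition "add_prog = Rec (Proj 0) (Comp Succ [Proj 1])"
private definition "pred_prog = Rec Zero (Proj 0)"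
private definition "diff_prog = Rec (Proj 0) (Comp pred_prog [Proj 1])"
private definition "sgn_prog = Rec Zero (Comp Succ [Zero])"
private definition "triangle_prog = Rec Zero (Comp add_prog [Comp Succ [Proj 0], Proj 1])"
private definition "pair_prog = Comp add_prog [Comp triangle_prog [add_prog], Proj 0]"
private definition
  "root_prog = Mu (Comp diff_prog [Comp triangle_prog [Comp Succ [Proj 0]], Comp Succ [Proj 1]])"
private definition "fst_prog = Comp diff_prog [Comp triangle_prog [root_prog], Proj 0]"
private definition "snd_prog = Comp diff_prog [fst_prog, root_prog]"
text \<open>A recursion whose length is the sign of the first argument makes at most one step, so it
  acts as a conditional. The step reads only the original arguments and passes the second one,
  paired with the predecessor of the first, to \<open>g\<close>.\<close>

private definition "split_prog f g = Comp (Rec (Comp f [Proj 1]) (Comp g [Comp pair_prog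
  [Proj 3, Comp pred_prog [Proj 2]]])) [Comp sgn_prog [Proj 0], Proj 0, Proj 1]"

private lemma add_prog: "yields X add_prog [n, m] (n + m)"
  unfolding add_prog_def
proof (induction n)
  case (Suc n)
  show ?case using yields.Rec_Suc[OF Suc yields_Comp1[OF yields_Projs(2) yields.Succ]] by simp
qed (auto intro: yields.Rec_0 yields_Projs)

private lemma pred_prog: "yields X pred_prog [n] (n - 1)"
  unfolding pred_prog_def
proof (induction n)
  case (Suc n)
  show ?case using yields.Rec_Suc[OF Suc yields_Projs(1)] by simp
qed (auto intro: yields.Rec_0 yields.Zero)

private lemma diff_prog: "yields X diff_prog [n, m] (m - n)"
  unfolding diff_prog_def
proof (induction n)
  case (Suc n)
  show ?case using yields.Rec_Suc[OF Suc yields_Comp1[OF yields_Projs(2) pred_prog]] by simp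
qed (auto intro: yields.Rec_0 yields_Projs)

private lemma sgn_prog: "yields X sgn_prog [n] (of_bool (n \<noteq> 0))"
  unfolding sgn_prog_def
proof (induction n)
  case (Suc n)
  show ?case using yields.Rec_Suc[OF Suc yields_Comp1[OF yields.Zero yields.Succ]] by simp
qed (auto intro: yields.Rec_0 yields.Zero)

private lemma triangle_prog: "yields X triangle_prog [n] (triangle n)"
  unfolding triangle_prog_def
proof (induction n)
  case (Suc n)
  show ?case
    using yields.Rec_Suc[OF Suc yields_Comp2[OF
          yields_Comp1[OF yields_Projs(1) yields.Succ] yields_Projs(2) add_prog]]
    by (simp add: add.commute)
qed (auto intro: yields.Rec_0 yields.Zero)

private lemma pair_prog: "yields X pair_prog [m, n] (prod_encode (m, n))"
  unfolding pair_prog_def prod_encode_def prod.case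
  by (intro yields_Comp2[OF yields_Comp1[OF add_prog triangle_prog] yields_Projs(1) add_prog])

private lemma triangle_mono: "m \<le> n \<Longrightarrow> triangle m \<le> triangle n"
  unfolding triangle_def by (intro div_le_mono mult_le_mono) auto

text \<open>Since \<open>prod_encode (a, b) = triangle (a + b) + a\<close>, the code lies below
  \<open>triangle (Suc n)\<close> exactly from \<open>n = a + b\<close> on.\<close>

private lemma root_prog: "yields X root_prog [prod_encode (a, b)] (a + b)"
  unfolding root_prog_def
proof (rule yields.Mu)
  have step: "yields X (Comp diff_prog [Comp triangle_prog [Comp Succ [Proj 0]], Comp Succ [Proj 1]])
      [n, m] (Suc m - triangle (Suc n))" for n m
    by (rule yields_Comp2[OF yields_Comp1[OF yields_Comp1[OF yields_Projs(1) yields.Succ]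
            triangle_prog] yields_Comp1[OF yields_Projs(2) yields.Succ] diff_prog])
  show "yields X (Comp diff_prog [Comp triangle_prog [Comp Succ [Proj 0]], Comp Succ [Proj 1]])
      [a + b, prod_encode (a, b)] 0"
    using step[of "a + b" "prod_encode (a, b)"] by (simp add: prod_encode_def)
  fix m assume "m < a + b"
  then have "triangle (Suc m) \<le> prod_encode (a, b)"
    using triangle_mono[of "Suc m" "a + b"] by (simp add: prod_encode_def)
  then show "\<exists>y. yields X (Comp diff_prog [Comp triangle_prog [Comp Succ [Proj 0]],
      Comp Succ [Proj 1]]) [m, prod_encode (a, b)] (Suc y)"
    using step[of m "prod_encode (a, b)"] by (metis Suc_diff_le)
qed

private lemma fst_prog: "yields X fst_prog [prod_encode (a, b)] a"
  using yields_Comp2[OF yields_Comp1[OF root_prog triangle_prog] yields_Projs(1) diff_prog, of X a b]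
  by (simp add: fst_prog_def prod_encode_def)

private lemma snd_prog: "yields X snd_prog [prod_encode (a, b)] b"
  using yields_Comp2[OF fst_prog root_prog diff_prog, of X a b] by (simp add: snd_prog_def)

\<comment> \<open>The branch \<open>g\<close> is only run when \<open>n \<noteq> 0\<close>, so it need not halt on junk codes.\<close>
private lemma split_prog:
  assumes "yields X f [a] y" "n \<noteq> 0 \<Longrightarrow> yields X g [prod_encode (a, n - 1)] z"
  shows "yields X (split_prog f g) [n, a] (if n = 0 then y else z)"
proof -
  let ?R = "Rec (Comp f [Proj 1]) (Comp g [Comp pair_prog [Proj 3, Comp pred_prog [Proj 2]]])"
  have 0: "yields X ?R [0, n, a] y"
    by (rule yields.Rec_0[OF yields_Comp1[OF yields_Projs(2) assms(1)]])
  have "yields X ?R [of_bool (n \<noteq> 0), n, a] (if n = 0 then y else z)"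
  proof (cases "n = 0")
    case False
    have "yields X ?R [Suc 0, n, a] z"
      by (rule yields.Rec_Suc[OF 0 yields_Comp1[OF yields_Comp2[OF yields_Projs(4)
                yields_Comp1[OF yields_Projs(3) pred_prog] pair_prog] assms(2)[OF False]]])
    then show ?thesis using False by simp
  qed (use 0 in simp)
  then show ?thesis
    unfolding split_prog_def
    by (rule yields_Comp3[OF yields_Comp1[OF yields_Projs(1) sgn_prog] yields_Projs(1)
          yields_Projs(2)])
qed

section \<open>Closure properties of computable functions on coded types\<close>

lemma rec_in_comp:
  assumes "rec_in X g" "rec_in X f"
  shows "rec_in X (\<lambda>a. g (f a))"
proof -
  obtain q where q: "\<And>b. yields X q [encode b] (encode (g b))"
    using assms(1) unfolding rec_in_def by blast
  obtain p where p: "\<And>a. yields X p [encode a] (encode (f a))"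
    using assms(2) unfolding rec_in_def by blast
  show ?thesis by (rule rec_inI[OF yields_Comp1[OF p q]])
qed

lemma rec_in_id: "rec_in X (\<lambda>a. a)"
  by (rule rec_inI[OF yields_Projs(1)])

lemma rec_in_const: "rec_in X (\<lambda>a. c)"
proof -
  have "\<exists>e. \<forall>x. yields X e [x] n" for n
  proof (induction n)
    case (Suc n)
    then show ?case using yields_Comp1 yields.Succ by metis
  qed (blast intro: yields.Zero)
  then show ?thesis unfolding rec_in_def by blast
qed

lemma rec_in_Pair:
  assumes "rec_in X f" "rec_in X g"
  shows "rec_in X (\<lambda>a. (f a, g a))"
proof -
  obtain p where p: "\<And>a. yields X p [encode a] (encode (f a))"
    using assms(1) unfolding rec_in_def by blast
  obtain q where q: "\<And>a. yields X q [encode a] (encode (g a))"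
    using assms(2) unfolding rec_in_def by blast
  show ?thesis by (rule rec_inI) (use yields_Comp2[OF p q pair_prog] in simp)
qed

lemma rec_in_comp2:
  assumes "rec_in X (\<lambda>p. h (fst p) (snd p))" "rec_in X f" "rec_in X g"
  shows "rec_in X (\<lambda>a. h (f a) (g a))"
  using rec_in_comp[OF assms(1) rec_in_Pair[OF assms(2,3)]] by simp

text \<open>The result types may differ. This settles every operation that leaves codes unchanged,
  and every reformulation with equal values.\<close>

lemma rec_in_recode:
  assumes "rec_in X f" "\<And>a. encode (g a) = encode (f a)"
  shows "rec_in X g"
  using assms by (simp add: rec_in_def)

lemma rec_in_fst: "rec_in X f \<Longrightarrow> rec_in X (\<lambda>a. fst (f a))"
  by (rule rec_in_comp[of X fst, OF rec_inI]) (simp, rule fst_prog)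

lemma rec_in_snd: "rec_in X f \<Longrightarrow> rec_in X (\<lambda>a. snd (f a))"
  by (rule rec_in_comp[of X snd, OF rec_inI]) (simp, rule snd_prog)

lemma rec_in_Suc: "rec_in X f \<Longrightarrow> rec_in X (\<lambda>a. Suc (f a))"
  by (rule rec_in_comp[of X Suc, OF rec_inI]) (simp, rule yields.Succ)

lemma rec_in_add: "rec_in X f \<Longrightarrow> rec_in X g \<Longrightarrow> rec_in X (\<lambda>a. f a + g a :: nat)"
  by (rule rec_in_comp2[of X "(+)", OF rec_inI])
    (unfold encode_prod_def encode_nat_def, rule yields_Comp2[OF fst_prog snd_prog add_prog])

lemma rec_in_diff: "rec_in X f \<Longrightarrow> rec_in X g \<Longrightarrow> rec_in X (\<lambda>a. f a - g a :: nat)"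
  by (rule rec_in_comp2[of X "(-)", OF rec_inI])
    (unfold encode_prod_def encode_nat_def, rule yields_Comp2[OF snd_prog fst_prog diff_prog])

lemma rec_in_if:
  assumes "rec_in X b" "rec_in X f" "rec_in X g"
  shows "rec_in X (\<lambda>a. if b a then f a else g a)"
proof -
  obtain p where p: "\<And>a. yields X p [encode a] (encode (b a))"
    using assms(1) unfolding rec_in_def by blast
  obtain q where q: "\<And>a. yields X q [encode a] (encode (f a))"
    using assms(2) unfolding rec_in_def by blast
  obtain r where r: "\<And>a. yields X r [encode a] (encode (g a))"
    using assms(3) unfolding rec_in_def by blast
  have "yields X (Comp (split_prog r (Comp q [fst_prog])) [p, Proj 0]) [encode a]
      (if encode (b a) = 0 then encode (g a) else encode (f a))" for a
    by (rule yields_Comp2[OF p yields_Projs(1) split_prog[OF r yields_Comp1[OF fst_prog q]]])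
  moreover have "(if encode (b a) = 0 then encode (g a) else encode (f a)) =
      encode (if b a then f a else g a)" for a
    by simp
  ultimately show ?thesis by (intro rec_inI) (simp only:)
qed

lemma rec_in_case_nat:
  assumes "rec_in X n" "rec_in X f" "rec_in X (\<lambda>p. g (fst p) (snd p))"
  shows "rec_in X (\<lambda>a. case n a of 0 \<Rightarrow> f a | Suc m \<Rightarrow> g a m)"
proof -
  obtain p where p: "\<And>a. yields X p [encode a] (encode (n a))"
    using assms(1) unfolding rec_in_def by blast
  obtain q where q: "\<And>a. yields X q [encode a] (encode (f a))"
    using assms(2) unfolding rec_in_def by blast
  obtain r where r: "\<And>c. yields X r [encode c] (encode (g (fst c) (snd c)))"
    using assms(3) unfolding rec_in_def by blast
  have "yields X (Comp (split_prog q r) [p, Proj 0]) [encode a]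
      (if encode (n a) = 0 then encode (f a) else encode (g a (n a - 1)))" for a
    by (rule yields_Comp2[OF p yields_Projs(1) split_prog[OF q]])
      (use r[of "(a, n a - 1)"] in simp)
  moreover have "(if encode (n a) = 0 then encode (f a) else encode (g a (n a - 1))) =
      encode (case n a of 0 \<Rightarrow> f a | Suc m \<Rightarrow> g a m)" for a
    by (cases "n a") auto
  ultimately show ?thesis by (intro rec_inI) (simp only:)
qed

lemma rec_in_case_option:
  assumes "rec_in X x" "rec_in X f" "rec_in X (\<lambda>p. g (fst p) (snd p))"
  shows "rec_in X (\<lambda>a. case x a of None \<Rightarrow> f a | Some y \<Rightarrow> g a y)"
proof -
  obtain p where p: "\<And>a. yields X p [encode a] (encode (x a))"
    using assms(1) unfolding rec_in_def by blast
  obtain q where q: "\<And>a. yields X q [encode a] (encode (f a))"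
    using assms(2) unfolding rec_in_def by blast
  obtain r where r: "\<And>c. yields X r [encode c] (encode (g (fst c) (snd c)))"
    using assms(3) unfolding rec_in_def by blast
  \<comment> \<open>For \<open>None\<close> the value \<open>the (x a)\<close> is arbitrary, but the
    zero test then selects the other branch.\<close>
  have "yields X (Comp (split_prog q r) [p, Proj 0]) [encode a]
      (if encode (x a) = 0 then encode (f a) else encode (g a (the (x a))))" for a
    by (rule yields_Comp2[OF p yields_Projs(1) split_prog[OF q]])
      (use r[of "(a, the (x a))"] in \<open>auto split: option.splits\<close>)
  moreover have "(if encode (x a) = 0 then encode (f a) else encode (g a (the (x a)))) =
      encode (case x a of None \<Rightarrow> f a | Some y \<Rightarrow> g a y)" for a
    by (cases "x a") auto
  ultimately show ?thesis by (intro rec_inI) (simp only:)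
qed

lemma rec_in_case_list:
  assumes "rec_in X xs" "rec_in X f" "rec_in X (\<lambda>p. g (fst p) (fst (snd p)) (snd (snd p)))"
  shows "rec_in X (\<lambda>a. case xs a of [] \<Rightarrow> f a | y # ys \<Rightarrow> g a y ys)"
proof -
  obtain p where p: "\<And>a. yields X p [encode a] (encode (xs a))"
    using assms(1) unfolding rec_in_def by blast
  obtain q where q: "\<And>a. yields X q [encode a] (encode (f a))"
    using assms(2) unfolding rec_in_def by blast
  obtain r where r: "\<And>c. yields X r [encode c] (encode (g (fst c) (fst (snd c)) (snd (snd c))))"
    using assms(3) unfolding rec_in_def by blast
  have "yields X (Comp (split_prog q r) [p, Proj 0]) [encode a]
      (if encode (xs a) = 0 then encode (f a) else encode (g a (hd (xs a)) (tl (xs a))))" for a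
    by (rule yields_Comp2[OF p yields_Projs(1) split_prog[OF q]])
      (use r[of "(a, hd (xs a), tl (xs a))"] in \<open>cases "xs a"; simp\<close>)
  moreover have "(if encode (xs a) = 0 then encode (f a) else encode (g a (hd (xs a)) (tl (xs a)))) =
      encode (case xs a of [] \<Rightarrow> f a | y # ys \<Rightarrow> g a y ys)" for a
    by (cases "xs a") auto
  ultimately show ?thesis by (intro rec_inI) (simp only:)
qed

text \<open>The code of a nonempty list is the successor of the code of the pair of its head and
  tail.\<close>

lemma rec_in_Cons:
  assumes "rec_in X f" "rec_in X g"
  shows "rec_in X (\<lambda>a. f a # g a)"
proof -
  have "rec_in X (\<lambda>a. encode (f a, g a))"
    by (rule rec_in_recode[OF rec_in_Pair[OF assms]]) simp
  then show ?thesis by (rule rec_in_recode[OF rec_in_Suc]) simp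
qed

lemma rec_in_Some: "rec_in X f \<Longrightarrow> rec_in X (\<lambda>a. Some (f a))"
proof -
  assume "rec_in X f"
  then have "rec_in X (\<lambda>a. encode (f a))" by (rule rec_in_recode) simp
  then show ?thesis by (rule rec_in_recode[OF rec_in_Suc]) simp
qed

text \<open>On codes this is the identity, as are the next two operations.\<close>

lemma rec_in_list_decode: "rec_in X f \<Longrightarrow> rec_in X (\<lambda>a. list_decode (f a))"
  by (erule rec_in_recode) simp

lemma rec_in_list_encode: "rec_in X f \<Longrightarrow> rec_in X (\<lambda>a. list_encode (f a))"
  by (erule rec_in_recode) simp

lemma rec_in_prod_decode: "rec_in X f \<Longrightarrow> rec_in X (\<lambda>a. prod_decode (f a))"
  by (erule rec_in_recode) simp

lemma rec_in_rec_nat: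
  assumes "rec_in X n" "rec_in X f" "rec_in X (\<lambda>p. g (fst p) (fst (snd p)) (snd (snd p)))"
  shows "rec_in X (\<lambda>a. rec_nat (f a) (g a) (n a))"
proof -
  obtain p where p: "\<And>a. yields X p [encode a] (encode (n a))"
    using assms(1) unfolding rec_in_def by blast
  obtain q where q: "\<And>a. yields X q [encode a] (encode (f a))"
    using assms(2) unfolding rec_in_def by blast
  obtain r where r: "\<And>c. yields X r [encode c] (encode (g (fst c) (fst (snd c)) (snd (snd c))))"
    using assms(3) unfolding rec_in_def by blast
  let ?r = "Comp r [Comp pair_prog [Proj 2, Comp pair_prog [Proj 0, Proj 1]]]"
  have R: "yields X (Rec q ?r) [k, encode a] (encode (rec_nat (f a) (g a) k))" for a k
  proof (induction k)
    case (Suc k)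
    have "yields X ?r [k, encode (rec_nat (f a) (g a) k), encode a]
        (encode (g a k (rec_nat (f a) (g a) k)))"
      by (rule yields_Comp1[OF yields_Comp2[OF yields_Projs(3)
              yields_Comp2[OF yields_Projs(1,2) pair_prog] pair_prog]])
        (use r[of "(a, k, rec_nat (f a) (g a) k)"] in simp)
    then show ?case using yields.Rec_Suc[OF Suc] by simp
  qed (auto intro: yields.Rec_0 q)
  have "yields X (Comp (Rec q ?r) [p, Proj 0]) [encode a] (encode (rec_nat (f a) (g a) (n a)))" for a
    by (rule yields_Comp2[OF p yields_Projs(1)]) (use R in simp)
  then show ?thesis by (rule rec_inI)
qed

text \<open>The first half gives total search in \<open>rec_in_Least\<close>. The second half, that
  every output is a witness, is what \<open>ce_ex\<close> needs to identify the domain of the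
  search.\<close>

lemma halts_search:
  assumes "rec_in X (\<lambda>p. P (fst p) (snd p))"
  shows "\<exists>e. \<forall>a. (\<forall>n. P a n \<longrightarrow> yields X e [encode a] (LEAST n. P a n)) \<and>
    (\<forall>y. yields X e [encode a] y \<longrightarrow> P a y)"
proof -
  obtain p where p: "\<And>c. yields X p [encode c] (encode (P (fst c) (snd c)))"
    using assms unfolding rec_in_def by blast
  \<comment> \<open>\<open>Mu\<close> looks for zeros, so the truth value is subtracted from
    1.\<close>
  let ?p = "Comp diff_prog [Comp p [Comp pair_prog [Proj 1, Proj 0]], Comp Succ [Zero]]"
  have step: "yields X ?p [n, encode a] (Suc 0 - of_bool (P a n))" for n a
  proof -
    have "yields X p [prod_encode (encode a, n)] (of_bool (P a n))"
      using p[of "(a, n)"] by simp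
    then show ?thesis
      by (rule yields_Comp2[OF yields_Comp1[OF yields_Comp2[OF yields_Projs(2,1) pair_prog]]
            yields_Comp1[OF yields.Zero yields.Succ] diff_prog])
  qed
  have "yields X (Mu ?p) [encode a] (LEAST n. P a n)" if "P a n" for a n
  proof (rule yields.Mu)
    show "yields X ?p [LEAST n. P a n, encode a] 0"
      using step[of "LEAST n. P a n" a] LeastI[of "P a", OF that] by simp
    show "\<exists>y. yields X ?p [m, encode a] (Suc y)" if "m < (LEAST n. P a n)" for m
      using step[of m a] not_less_Least[OF that] by auto
  qed
  moreover have "P a y" if "yields X (Mu ?p) [encode a] y" for a y
  proof (rule ccontr)
    assume "\<not> P a y"
    then have "yields X ?p [y, encode a] 1" using step[of y a] by simp
    moreover have "yields X ?p [y, encode a] 0" using that by (auto elim: Mu_E)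
    ultimately show False using yields_deterministic by fastforce
  qed
  ultimately show ?thesis by blast
qed

lemma rec_in_Least:
  assumes "rec_in X (\<lambda>p. P (fst p) (snd p))" "\<And>a. \<exists>n. P a n"
  shows "rec_in X (\<lambda>a. LEAST n :: nat. P a n)"
  using halts_search[OF assms(1)] assms(2) by (simp add: rec_in_def) blast

end

lemma ce_ex:
  assumes "rec_in {} (\<lambda>p. P (fst p) (snd p))"
  shows "ce {a. \<exists>n :: nat. P a n}"
  using halts_search[OF assms] unfolding ce_def by fastforce

section \<open>Derived closure rules for logic, arithmetic and lists\<close>

named_theorems rec_intros

lemmas [rec_intros] = rec_in_id rec_in_const rec_in_Pair rec_in_fst rec_in_snd rec_in_Suc rec_in_add
  rec_in_diff rec_in_if rec_in_case_nat rec_in_case_option rec_in_case_list rec_in_Cons rec_in_Some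
  rec_in_list_decode rec_in_list_encode rec_in_prod_decode rec_in_rec_nat rec_in_Least

lemma rec_in_Not [rec_intros]: "rec_in X b \<Longrightarrow> rec_in X (\<lambda>a. \<not> b a)"
proof -
  assume "rec_in X b"
  then have "rec_in X (\<lambda>a. if b a then False else True)" by (intro rec_intros)
  then show ?thesis by (rule rec_in_recode) simp
qed

lemma rec_in_conj [rec_intros]: "rec_in X b \<Longrightarrow> rec_in X c \<Longrightarrow> rec_in X (\<lambda>a. b a \<and> c a)"
proof -
  assume "rec_in X b" "rec_in X c"
  then have "rec_in X (\<lambda>a. if b a then c a else False)" by (intro rec_intros)
  then show ?thesis by (rule rec_in_recode) simp
qed

lemma rec_in_disj [rec_intros]: "rec_in X b \<Longrightarrow> rec_in X c \<Longrightarrow> rec_in X (\<lambda>a. b a \<or> c a)"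
proof -
  assume "rec_in X b" "rec_in X c"
  then have "rec_in X (\<lambda>a. if b a then True else c a)" by (intro rec_intros)
  then show ?thesis by (rule rec_in_recode) simp
qed

lemma rec_in_le [rec_intros]:
  "rec_in X f \<Longrightarrow> rec_in X g \<Longrightarrow> rec_in X (\<lambda>a. (f a :: nat) \<le> g a)"
proof -
  assume "rec_in X f" "rec_in X g"
  then have "rec_in X (\<lambda>a. case f a - g a of 0 \<Rightarrow> True | Suc _ \<Rightarrow> False)" by (intro rec_intros)
  then show ?thesis by (rule rec_in_recode) (auto split: nat.split)
qed

lemma rec_in_less [rec_intros]:
  "rec_in X f \<Longrightarrow> rec_in X g \<Longrightarrow> rec_in X (\<lambda>a. (f a :: nat) < g a)"
  using rec_in_le[OF rec_in_Suc] by (simp add: Suc_le_eq)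

lemma rec_in_eq [rec_intros]:
  "rec_in X f \<Longrightarrow> rec_in X g \<Longrightarrow> rec_in X (\<lambda>a. (f a :: nat) = g a)"
  by (simp add: eq_iff rec_intros)

lemma rec_in_div2 [rec_intros]: "rec_in X f \<Longrightarrow> rec_in X (\<lambda>a. f a div 2 :: nat)"
proof -
  assume f: "rec_in X f"
  have "\<exists>k. n < Suc (Suc (k + k))" for n :: nat
    by (rule exI[of _ n]) simp
  \<comment> \<open>Division is replaced by a search: \<open>n div 2\<close> is the least
    \<open>k\<close> with \<open>n < 2 * k + 2\<close>.\<close>
  then have "rec_in X (\<lambda>n. LEAST k. n < Suc (Suc (k + k)))" by (intro rec_intros)
  moreover have "(LEAST k. n < Suc (Suc (k + k))) = n div 2" for n :: nat
    by (rule Least_equality) presburger+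
  ultimately show ?thesis using rec_in_comp[OF _ f] by simp
qed

lemma rec_in_even [rec_intros]: "rec_in X f \<Longrightarrow> rec_in X (\<lambda>a. even (f a :: nat))"
proof -
  assume "rec_in X f"
  then have "rec_in X (\<lambda>a. f a div 2 + f a div 2 = f a)" by (intro rec_intros)
  moreover have "n div 2 + n div 2 = n \<longleftrightarrow> even n" for n :: nat by presburger
  ultimately show ?thesis by simp
qed

lemma rec_in_drop [rec_intros]:
  "rec_in X n \<Longrightarrow> rec_in X xs \<Longrightarrow> rec_in X (\<lambda>a. drop (n a) (xs a))"
proof -
  assume "rec_in X n" "rec_in X xs"
  then have "rec_in X (\<lambda>a. rec_nat (xs a) (\<lambda>_ zs. case zs of [] \<Rightarrow> [] | _ # ys \<Rightarrow> ys) (n a))"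
    by (intro rec_intros)
  moreover have "rec_nat ys (\<lambda>_ zs. case zs of [] \<Rightarrow> [] | _ # ys \<Rightarrow> ys) k = drop k ys"
    for k and ys :: "'b list"
  proof (induction k)
    case (Suc k)
    then show ?case by (cases "drop k ys") (simp_all add: drop_Suc flip: tl_drop)
  qed simp
  ultimately show ?thesis by simp
qed

lemma rec_in_length [rec_intros]: "rec_in X xs \<Longrightarrow> rec_in X (\<lambda>a. length (xs a))"
proof (erule rec_in_comp[rotated])
  have "\<exists>n. case drop n ys of [] \<Rightarrow> True | _ # _ \<Rightarrow> False" for ys :: "'b list"
    by (rule exI[of _ "length ys"]) simp
  then have "rec_in X (\<lambda>ys :: 'b list. LEAST n. case drop n ys of [] \<Rightarrow> True | _ # _ \<Rightarrow> False)"
    by (intro rec_intros)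
  moreover have "(case drop n ys of [] \<Rightarrow> True | _ # _ \<Rightarrow> False) \<longleftrightarrow> length ys \<le> n" for n and ys :: "'b list"
    by (cases "drop n ys") (auto dest: arg_cong[where f = length])
  moreover have "(LEAST n. length ys \<le> n) = length ys" for ys :: "'b list"
    by (rule Least_equality) auto
  ultimately show "rec_in X (length :: 'b list \<Rightarrow> nat)" by simp
qed

text \<open>The numerical recursion runs through the suffixes of \<open>xs\<close>, shortest first:
  after \<open>k\<close> steps its value belongs to the last \<open>k\<close> entries. Thus list
  recursion inherits computability from recursion on numbers.\<close>

lemma rec_nat_rec_list:
  "rec_nat f (\<lambda>i r. case drop (length xs - Suc i) xs of [] \<Rightarrow> r | y # ys \<Rightarrow> g y ys r) (length xs) =
    rec_list f g xs"
proof -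
  have "k \<le> length xs \<Longrightarrow>
    rec_nat f (\<lambda>i r. case drop (length xs - Suc i) xs of [] \<Rightarrow> r | y # ys \<Rightarrow> g y ys r) k =
    rec_list f g (drop (length xs - k) xs)" for k
  proof (induction k)
    case (Suc k)
    then have "drop (length xs - Suc k) xs = xs ! (length xs - Suc k) # drop (length xs - k) xs"
      by (simp add: Suc_diff_Suc flip: Cons_nth_drop_Suc)
    with Suc show ?case by simp
  qed simp
  from this[of "length xs"] show ?thesis by simp
qed

lemma rec_in_rec_list [rec_intros]:
  assumes "rec_in X xs" "rec_in X f"
    "rec_in X (\<lambda>p. g (fst p) (fst (snd p)) (fst (snd (snd p))) (snd (snd (snd p))))"
  shows "rec_in X (\<lambda>a. rec_list (f a) (g a) (xs a))"
proof -
  have "rec_in X (\<lambda>a. rec_nat (f a)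
    (\<lambda>i r. case drop (length (xs a) - Suc i) (xs a) of [] \<Rightarrow> r | y # ys \<Rightarrow> g a y ys r) (length (xs a)))"
    \<comment> \<open>The argument arrives as \<open>((a, i, r), y, ys)\<close> and is rearranged to
      the \<open>(a, y, ys, r)\<close> that \<open>g\<close> expects.\<close>
    by (intro rec_intros assms rec_in_comp[OF assms(1)] rec_in_comp[OF assms(3),
      of "\<lambda>p. (fst (fst p), fst (snd p), snd (snd p), snd (snd (fst p)))", simplified])
  then show ?thesis by (simp add: rec_nat_rec_list)
qed

lemma rec_in_append [rec_intros]:
  assumes "rec_in X xs" "rec_in X ys"
  shows "rec_in X (\<lambda>a. xs a @ ys a)"
proof -
  have "rec_in X (\<lambda>a. rec_list (ys a) (\<lambda>z _ r. z # r) (xs a))"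
    by (intro rec_intros assms)
  moreover have "rec_list vs (\<lambda>z _ r. z # r) us = us @ vs" for us vs :: "'b list"
    by (induction us) auto
  ultimately show ?thesis by simp
qed

lemma rec_in_map [rec_intros]:
  assumes "rec_in X (\<lambda>p. g (fst p) (snd p))" "rec_in X xs"
  shows "rec_in X (\<lambda>a. map (g a) (xs a))"
proof -
  have "rec_in X (\<lambda>a. rec_list [] (\<lambda>z _ r. g a z # r) (xs a))"
    by (intro rec_intros assms(2) rec_in_comp2[OF assms(1)])
  moreover have "rec_list [] (\<lambda>z _ r. g a z # r) us = map (g a) us" for a us
    by (induction us) auto
  ultimately show ?thesis by simp
qed

lemma rec_in_distinct [rec_intros]:
  "rec_in X xs \<Longrightarrow> rec_in X (\<lambda>a. distinct (xs a :: nat list))"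
proof (erule rec_in_comp[rotated])
  have "rec_in X (\<lambda>xs. rec_list True
    (\<lambda>y ys r. \<not> rec_list False (\<lambda>z _ s. z = y \<or> s) ys \<and> r) (xs :: nat list))"
    by (intro rec_intros)
  moreover have "rec_list False (\<lambda>z _ s. z = y \<or> s) ys \<longleftrightarrow> y \<in> set ys" for y :: nat and ys
    by (induction ys) auto
  moreover have "rec_list True (\<lambda>y ys r. y \<notin> set ys \<and> r) xs = distinct xs" for xs :: "nat list"
    by (induction xs) auto
  ultimately show "rec_in X (distinct :: nat list \<Rightarrow> bool)" by simp
qed

text \<open>Unlike \<open>nth\<close>, this has a definite value beyond the end of the list, which
  makes it computable everywhere.\<close>

definition lookup :: "'a list \<Rightarrow> nat \<Rightarrow> 'a option" where
  "lookup xs i = (case drop i xs of [] \<Rightarrow> None | x # _ \<Rightarrow> Some x)"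

lemma lookup_eq: "lookup xs i = (if i < length xs then Some (xs ! i) else None)"
  by (auto simp: lookup_def split: list.split dest: arg_cong[where f = length])
    (metis drop_eq_Nil2 hd_drop_conv_nth list.sel(1) list.simps(3) not_le)

lemma rec_in_lookup [rec_intros]:
  "rec_in X xs \<Longrightarrow> rec_in X i \<Longrightarrow> rec_in X (\<lambda>a. lookup (xs a) (i a))"
  unfolding lookup_def by (intro rec_intros)

text \<open>The table of earlier values grows by consing, so it lists them from \<open>n - 1\<close>
  down to \<open>0\<close>, and the value at \<open>y < n\<close> stands at position
  \<open>n - Suc y\<close>.\<close>

lemma rec_in_course_of_values:
  assumes F: "\<And>a n. F a n = H a n (map (F a) (rev [0..<n]))"
    and H: "rec_in X (\<lambda>p. H (fst p) (fst (snd p)) (snd (snd p)))"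
  shows "rec_in X (\<lambda>p. F (fst p) (snd p))"
proof -
  have H': "rec_in X (\<lambda>a. H (f a) (g a) (h a))" if "rec_in X f" "rec_in X g" "rec_in X h"
    for f :: "'d::coded \<Rightarrow> _" and g h
    using rec_in_comp[OF H rec_in_Pair[OF that(1) rec_in_Pair[OF that(2,3)]]] by simp
  have "rec_in X (\<lambda>p. H (fst p) (snd p) (rec_nat [] (\<lambda>m T. H (fst p) m T # T) (snd p)))"
    by (intro rec_intros H')
  moreover have "rec_nat [] (\<lambda>m T. H a m T # T) n = map (F a) (rev [0..<n])" for a n
    by (induction n) (simp_all flip: F)
  ultimately show ?thesis by (simp flip: F)
qed

section \<open>Evaluation with a partial oracle and bounded search\<close>

text \<open>The bound \<open>t\<close> limits only the searches of \<open>Mu\<close>. Such a search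
  halts at the first zero or undefined value, and at \<open>t\<close> at the latest, so its
  \<open>LEAST\<close> always has a witness.\<close>

fun bounded_eval :: "(nat \<Rightarrow> bool option) \<Rightarrow> nat \<Rightarrow> prog \<Rightarrow> nat list \<Rightarrow> nat option" where
  "bounded_eval Q t Zero xs = Some 0"
| "bounded_eval Q t Succ xs = (case xs of [] \<Rightarrow> None | x # _ \<Rightarrow> Some (Suc x))"
| "bounded_eval Q t (Proj i) xs = lookup xs i"
| "bounded_eval Q t Query xs = (case xs of [] \<Rightarrow> None | x # _ \<Rightarrow>
    (case Q x of None \<Rightarrow> None | Some b \<Rightarrow> Some (if b then 1 else 0)))"
| "bounded_eval Q t (Comp f gs) xs = (case those (map (\<lambda>g. bounded_eval Q t g xs) gs) of
    None \<Rightarrow> None | Some ys \<Rightarrow> bounded_eval Q t f ys)"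
| "bounded_eval Q t (Rec f g) xs = (case xs of [] \<Rightarrow> None | n # ys \<Rightarrow>
    rec_nat (bounded_eval Q t f ys)
      (\<lambda>m r. case r of None \<Rightarrow> None | Some y \<Rightarrow> bounded_eval Q t g (m # y # ys)) n)"
| "bounded_eval Q t (Mu f) xs =
    (let n = LEAST n. t \<le> n \<or>
        (case bounded_eval Q t f (n # xs) of None \<Rightarrow> True | Some y \<Rightarrow> y = 0)
     in if n < t then (case bounded_eval Q t f (n # xs) of None \<Rightarrow> None | Some _ \<Rightarrow> Some n)
        else None)"

lemma those_map_eq_Some_iff:
  "those (map f gs) = Some ys \<longleftrightarrow> list_all2 (\<lambda>g y. f g = Some y) gs ys"
  by (induction gs arbitrary: ys) (auto simp: list_all2_Cons1 split: option.split)

text \<open>The program \<open>e\<close> is fixed, so induction on \<open>e\<close> builds a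
  separate evaluator for each program and no universal machine is involved.\<close>

lemma rec_in_bounded_eval:
  assumes "rec_in X (\<lambda>p. Q (fst p) (snd p))" "rec_in X t"
  shows "rec_in X (\<lambda>p. bounded_eval (Q (fst p)) (t (fst p)) e (snd p))"
proof (induction e)
  case Zero
  show ?case by (simp add: rec_intros)
next
  case Succ
  show ?case by (simp only: bounded_eval.simps) (intro rec_intros)
next
  case (Proj i)
  show ?case by (simp only: bounded_eval.simps) (intro rec_intros)
next
  case Query
  show ?case by (simp only: bounded_eval.simps) (intro rec_intros rec_in_comp2[OF assms(1)])
next
  case (Comp f gs)
  have "rec_in X (\<lambda>p. those (map (\<lambda>g. bounded_eval (Q (fst p)) (t (fst p)) g (snd p)) gs))"
    using Comp(2)
  proof (induction gs)
    case (Cons g gs)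
    have g: "rec_in X (\<lambda>p. bounded_eval (Q (fst p)) (t (fst p)) g (snd p))"
      and gs: "rec_in X (\<lambda>p. those (map (\<lambda>g. bounded_eval (Q (fst p)) (t (fst p)) g (snd p)) gs))"
      using Cons by auto
    have "rec_in X (\<lambda>p. case bounded_eval (Q (fst p)) (t (fst p)) g (snd p) of None \<Rightarrow> None
      | Some y \<Rightarrow> (case those (map (\<lambda>g. bounded_eval (Q (fst p)) (t (fst p)) g (snd p)) gs) of
        None \<Rightarrow> None | Some ys \<Rightarrow> Some (y # ys)))"
      by (intro rec_intros g rec_in_comp[OF gs, of fst])
    moreover have "those (map h (g # gs)) = (case h g of None \<Rightarrow> None
      | Some y \<Rightarrow> (case those (map h gs) of None \<Rightarrow> None | Some ys \<Rightarrow> Some (y # ys)))" for h :: "_ \<Rightarrow> nat option"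
      by (auto split: option.split)
    ultimately show ?case by (simp only:)
  qed (simp add: rec_intros)
  then show ?case
    by (simp only: bounded_eval.simps) (intro rec_intros rec_in_comp2[OF Comp(1)])
next
  case (Rec f g)
  show ?case
    by (simp only: bounded_eval.simps) (intro rec_intros rec_in_comp2[OF Rec(1)] rec_in_comp2[OF Rec(2)])
next
  case (Mu f)
  have "\<exists>n. t \<le> n \<or> P n" for t :: nat and P by blast
  then show ?case
    by (simp only: bounded_eval.simps Let_def)
      (intro rec_intros rec_in_comp2[OF Mu] rec_in_comp[OF assms(2)])
qed

lemma bounded_eval_sound:
  assumes "\<And>x b. Q x = Some b \<Longrightarrow> b \<longleftrightarrow> x \<in> Z"
  shows "bounded_eval Q t e xs = Some y \<Longrightarrow> yields Z e xs y"
proof (induction e arbitrary: xs y)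
  case (Query xs)
  then show ?case
    using assms yields.Query[of Z "hd xs" "tl xs"]
    by (auto split: list.split_asm option.split_asm if_splits)
next
  case (Comp f gs)
  then obtain ys where "those (map (\<lambda>g. bounded_eval Q t g xs) gs) = Some ys"
    "bounded_eval Q t f ys = Some y"
    by (auto split: option.split_asm)
  then show ?case
    using Comp.IH by (auto intro!: yields.Comp simp: those_map_eq_Some_iff list_all2_conv_all_nth)
next
  case (Rec f g)
  then obtain n ys where xs: "xs = n # ys" by (auto split: list.split_asm)
  have "bounded_eval Q t (Rec f g) (n # ys) = Some y \<Longrightarrow> yields Z (Rec f g) (n # ys) y" for n y
  proof (induction n arbitrary: y)
    case (Suc n)
    then show ?case
      using Rec.IH(2) by (auto intro: yields.Rec_Suc split: option.split_asm)
  qed (simp add: Rec.IH yields.Rec_0)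
  then show ?case using Rec.prems xs by blast
next
  case (Mu f)
  let ?P = "\<lambda>n. t \<le> n \<or> (case bounded_eval Q t f (n # xs) of None \<Rightarrow> True | Some y \<Rightarrow> y = 0)"
  have y: "y = (LEAST n. ?P n)" "y < t" "bounded_eval Q t f (y # xs) \<noteq> None"
    using Mu.prems by (auto simp: Let_def split: if_splits option.split_asm)
  \<comment> \<open>The minimum satisfies the search condition because \<open>t\<close> does. As
    \<open>y < t\<close> and the value at \<open>y\<close> is defined, that value must be 0.\<close>
  have "?P y" unfolding y(1) by (rule LeastI[of _ t]) simp
  then have "yields Z f (y # xs) 0" using y(2,3) Mu.IH by (auto split: option.split_asm)
  moreover have "\<exists>z. yields Z f (m # xs) (Suc z)" if "m < y" for m
  proof -
    have "\<not> ?P m" using that not_less_Least y(1) by blast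
    then obtain z where "bounded_eval Q t f (m # xs) = Some (Suc z)"
      by (auto split: option.split_asm simp: gr0_conv_Suc)
    then show ?thesis using Mu.IH by blast
  qed
  ultimately show ?case by (rule yields.Mu)
qed (auto intro: yields.intros simp: lookup_eq split: list.split_asm if_splits)

definition answers :: "nat \<Rightarrow> nat set \<Rightarrow> (nat \<Rightarrow> bool option) \<Rightarrow> bool" where
  "answers k Z Q \<longleftrightarrow> (\<forall>x < k. Q x = Some (x \<in> Z))"

lemma answers_mono: "answers k Z Q \<Longrightarrow> j \<le> k \<Longrightarrow> answers j Z Q"
  by (simp add: answers_def)

lemma answers_max: "answers (max i j) Z Q \<longleftrightarrow> answers i Z Q \<and> answers j Z Q"
  by (auto simp: answers_def less_max_iff_disj)

text \<open>A halting computation makes finitely many queries and searches, so one number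
  \<open>k\<close> bounds both the queries and the search lengths, uniformly in the oracle and the
  bound.\<close>

lemma bounded_eval_complete:
  "yields Z e xs y \<Longrightarrow>
    \<exists>k. \<forall>Q t. k \<le> t \<longrightarrow> answers k Z Q \<longrightarrow> bounded_eval Q t e xs = Some y"
proof (induction rule: yields.induct)
  case (Query x xs)
  show ?case by (rule exI[of _ "Suc x"]) (auto simp: answers_def)
next
  case (Comp xs gs ys f z)
  then obtain k where k: "\<And>Q t. k \<le> t \<Longrightarrow> answers k Z Q \<Longrightarrow> bounded_eval Q t f ys = Some z"
    by blast
  have "\<exists>k. \<forall>Q t. k \<le> t \<longrightarrow> answers k Z Q \<longrightarrow>
      list_all2 (\<lambda>g y. bounded_eval Q t g xs = Some y) gs ys"
    using Comp(1)
  proof (induction gs ys rule: list_all2_induct)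
    case (Cons g gs y ys)
    then obtain i j where
      "\<forall>Q t. i \<le> t \<longrightarrow> answers i Z Q \<longrightarrow> bounded_eval Q t g xs = Some y"
      "\<forall>Q t. j \<le> t \<longrightarrow> answers j Z Q \<longrightarrow> list_all2 (\<lambda>g y. bounded_eval Q t g xs = Some y) gs ys"
      by blast
    then show ?case
      by (intro exI[of _ "max i j"]) (auto simp: answers_max)
  qed simp
  then obtain j where "\<And>Q t. j \<le> t \<Longrightarrow> answers j Z Q \<Longrightarrow>
      those (map (\<lambda>g. bounded_eval Q t g xs) gs) = Some ys"
    unfolding those_map_eq_Some_iff by blast
  with k show ?case
    by (intro exI[of _ "max j k"]) (auto simp: answers_max)
next
  case (Rec_Suc f g n xs y z)
  then obtain i j where
    "\<forall>Q t. i \<le> t \<longrightarrow> answers i Z Q \<longrightarrow> bounded_eval Q t (Rec f g) (n # xs) = Some y"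
    "\<forall>Q t. j \<le> t \<longrightarrow> answers j Z Q \<longrightarrow> bounded_eval Q t g (n # y # xs) = Some z"
    by blast
  then show ?case
    by (intro exI[of _ "max i j"]) (auto simp: answers_max)
next
  case (Mu f n xs)
  then obtain i where i: "\<And>Q t. i \<le> t \<Longrightarrow> answers i Z Q \<Longrightarrow> bounded_eval Q t f (n # xs) = Some 0"
    by blast
  have "\<forall>m \<in> {..<n}. \<exists>j. \<forall>Q t. j \<le> t \<longrightarrow> answers j Z Q \<longrightarrow>
      (\<exists>y. bounded_eval Q t f (m # xs) = Some (Suc y))"
    using Mu by fastforce
  then obtain J where J: "\<And>m Q t. m < n \<Longrightarrow> J m \<le> t \<Longrightarrow> answers (J m) Z Q \<Longrightarrow>
      \<exists>y. bounded_eval Q t f (m # xs) = Some (Suc y)"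
    by (metis lessThan_iff)
  \<comment> \<open>\<open>Suc n\<close> lets the search reach \<open>n\<close>; the other summands
    dominate the bounds for the runs at \<open>n\<close> and at each smaller argument.\<close>
  define k where "k = Suc n + i + sum J {..<n}"
  have Jk: "J m \<le> k" if "m < n" for m
    using member_le_sum[of m "{..<n}" J] that by (simp add: k_def)
  show ?case
  proof (intro exI[of _ k] allI impI)
    fix Q t assume t: "k \<le> t" and a: "answers k Z Q"
    have n: "bounded_eval Q t f (n # xs) = Some 0"
      using t a by (intro i) (auto simp: k_def elim: answers_mono)
    have m: "\<exists>y. bounded_eval Q t f (m # xs) = Some (Suc y)" if "m < n" for m
      using t a Jk[OF that] that by (intro J) (auto elim: answers_mono)
    have "(LEAST n. t \<le> n \<or> (case bounded_eval Q t f (n # xs) of None \<Rightarrow> True | Some y \<Rightarrow> y = 0)) = n"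
    proof (rule Least_equality)
      fix m assume *: "t \<le> m \<or> (case bounded_eval Q t f (m # xs) of None \<Rightarrow> True | Some y \<Rightarrow> y = 0)"
      show "n \<le> m"
      proof (rule ccontr)
        assume "\<not> n \<le> m"
        then show False using m[of m] * t by (auto simp: k_def)
      qed
    qed (simp add: n)
    then show "bounded_eval Q t (Mu f) xs = Some n"
      using n t by (simp add: k_def)
  qed
qed (auto simp: lookup_eq)

section \<open>Renaming elements in atomic diagrams\<close>

primrec rename_term :: "(nat \<Rightarrow> nat) \<Rightarrow> closed_term \<Rightarrow> closed_term" where
  "rename_term h (Elem n) = Elem (h n)"
| "rename_term h (App f ts) = App f (map (rename_term h) ts)"

primrec rename_atom :: "(nat \<Rightarrow> nat) \<Rightarrow> atom \<Rightarrow> atom" where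
  "rename_atom h (Eq s t) = Eq (rename_term h s) (rename_term h t)"
| "rename_atom h (Rel r ts) = Rel r (map (rename_term h) ts)"

primrec rename_literal :: "(nat \<Rightarrow> nat) \<Rightarrow> literal \<Rightarrow> literal" where
  "rename_literal h (Pos a) = Pos (rename_atom h a)"
| "rename_literal h (Neg a) = Neg (rename_atom h a)"

lemma wf_rename_term [simp]: "wf_term L (rename_term h t) \<longleftrightarrow> wf_term L t"
  by (induction t) (auto simp: list_all_iff)

lemma wf_rename_literal [simp]: "wf_literal L (rename_literal h l) \<longleftrightarrow> wf_literal L l"
proof -
  have "wf_atom L (rename_atom h a) \<longleftrightarrow> wf_atom L a" for a
    by (cases a) (auto simp: list_all_iff)
  then show ?thesis by (cases l) auto
qed

lemma term_value_rename:
  assumes "isomorphism L B A h"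
  shows "wf_term L t \<Longrightarrow> term_value A (rename_term h t) = h (term_value B t)"
proof (induction t)
  case (App f ts)
  then have "map (term_value A) (map (rename_term h) ts) = map h (map (term_value B) ts)"
    by (auto simp: list_all_iff)
  then show ?case
    using App.prems assms by (simp add: isomorphism_def del: map_map)
qed simp

lemma literal_true_rename:
  assumes "isomorphism L B A h" "wf_literal L l"
  shows "literal_true A (rename_literal h l) \<longleftrightarrow> literal_true B l"
proof -
  have inj: "h x = h y \<longleftrightarrow> x = y" for x y
    using assms(1) by (auto simp: isomorphism_def bij_def inj_def)
  have "atom_true A (rename_atom h a) \<longleftrightarrow> atom_true B a" if wf: "wf_atom L a" for a
  proof (cases a)
    case (Rel r ts)
    with wf have "map (term_value A) (map (rename_term h) ts) = map h (map (term_value B) ts)"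
      by (auto simp: list_all_iff term_value_rename[OF assms(1)])
    with Rel wf assms(1) show ?thesis by (simp add: isomorphism_def del: map_map)
  qed (use wf in \<open>simp add: term_value_rename[OF assms(1)] inj\<close>)
  with assms(2) show ?thesis by (cases l) auto
qed

lemma less_list_encode: "x \<in> set xs \<Longrightarrow> x < list_encode xs"
proof (induction xs)
  case (Cons a xs)
  then show ?case
    using le_prod_encode_1[of a "list_encode xs"] le_prod_encode_2[of "list_encode xs" a] by auto
qed simp

lemma less_if_in_list_decode: "x \<in> set (list_decode n) \<Longrightarrow> x < n"
  using less_list_encode[of x "list_decode n"] by simp

text \<open>
  On numbers that are not codes, renaming still preserves the shape of the coded tree, so that only
  codes of literals are mapped to codes of literals.
\<close>

function rename_term_code :: "(nat \<Rightarrow> nat) \<Rightarrow> nat \<Rightarrow> nat" where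
  "rename_term_code h n = (case list_decode n of [] \<Rightarrow> n | a # xs \<Rightarrow> (case xs of [] \<Rightarrow> n | b # ys \<Rightarrow>
    if a = 0 then list_encode (a # h b # ys)
    else list_encode (a # b # map (rename_term_code h) ys)))"
  by auto
termination
proof (relation "measure snd", goal_cases)
  case (2 h n a xs b ys y)
  then show ?case using less_if_in_list_decode[of y n] by simp
qed simp

declare rename_term_code.simps [simp del]

definition rename_atom_code :: "(nat \<Rightarrow> nat) \<Rightarrow> nat \<Rightarrow> nat" where
  "rename_atom_code h n = (case list_decode n of [] \<Rightarrow> n | a # xs \<Rightarrow>
    if a = 0 then list_encode (a # map (rename_term_code h) xs)
    else (case xs of [] \<Rightarrow> n | r # ys \<Rightarrow> list_encode (a # r # map (rename_term_code h) ys)))"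

definition rename_literal_code :: "(nat \<Rightarrow> nat) \<Rightarrow> nat \<Rightarrow> nat" where
  "rename_literal_code h n = (case list_decode n of [] \<Rightarrow> n | a # xs \<Rightarrow>
    list_encode (a # map (rename_atom_code h) xs))"

lemma rename_term_code: "rename_term_code h (term_code t) = term_code (rename_term h t)"
  by (induction t) (simp_all add: rename_term_code.simps del: list_encode.simps cong: map_cong)

lemma rename_literal_code: "rename_literal_code h (literal_code l) = literal_code (rename_literal h l)"
proof -
  have "rename_atom_code h (atom_code a) = atom_code (rename_atom h a)" for a
    by (cases a) (simp_all add: rename_atom_code_def rename_term_code o_def del: list_encode.simps)
  then show ?thesis
    by (cases l) (simp_all add: rename_literal_code_def del: list_encode.simps)
qed

text \<open>Entries of a decoded list are smaller than its code, so a finite part of a renaming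
  determines its effect. This is why finite injections can answer queries.\<close>

lemma rename_term_code_cong:
  "(\<And>m. m < n \<Longrightarrow> g m = h m) \<Longrightarrow> rename_term_code g n = rename_term_code h n"
proof (induction n rule: less_induct)
  case (less n)
  have "rename_term_code g y = rename_term_code h y" if "y \<in> set (list_decode n)" for y
    using that less less_if_in_list_decode by (meson less_trans)
  moreover have "g y = h y" if "y \<in> set (list_decode n)" for y
    using that less less_if_in_list_decode by blast
  ultimately show ?case
    unfolding rename_term_code.simps[of _ n]
    by (auto simp: list_encode_eq simp del: list_encode.simps split: list.split)
qed

lemma rename_literal_code_cong:
  assumes "\<And>m. m < n \<Longrightarrow> g m = h m"
  shows "rename_literal_code g n = rename_literal_code h n"
proof -
  have T: "rename_term_code g z = rename_term_code h z"
    if "y \<in> set (list_decode n)" "z \<in> set (list_decode y)" for y z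
    using assms that less_if_in_list_decode
    by (intro rename_term_code_cong) (meson less_trans)
  have "rename_atom_code g y = rename_atom_code h y" if "y \<in> set (list_decode n)" for y
    using T[OF that]
    by (auto simp: rename_atom_code_def list_encode_eq simp del: list_encode.simps split: list.split)
  then show ?thesis
    by (auto simp: rename_literal_code_def list_encode_eq simp del: list_encode.simps split: list.split)
qed

lemma rename_term_code_comp:
  "rename_term_code g (rename_term_code h n) = rename_term_code (\<lambda>m. g (h m)) n"
proof (induction n rule: less_induct)
  case (less n)
  then have "rename_term_code g (rename_term_code h y) = rename_term_code (\<lambda>m. g (h m)) y"
    if "y \<in> set (list_decode n)" for y
    using that less_if_in_list_decode by blast
  then show ?case
    unfolding rename_term_code.simps[of h n] rename_term_code.simps[of "\<lambda>m. g (h m)" n]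
    by (auto simp: rename_term_code.simps[of g "list_encode xs" for xs]
        rename_term_code.simps[of g n] list_encode_eq
        simp del: list_encode.simps split: list.split)
qed

text \<open>Together with \<open>rename_literal_code_id\<close> this shows that renaming by an
  inverse undoes a renaming on all numbers, including those that code no literal.\<close>

lemma rename_literal_code_comp:
  "rename_literal_code g (rename_literal_code h n) = rename_literal_code (\<lambda>m. g (h m)) n"
proof -
  have "rename_atom_code g (rename_atom_code h n) = rename_atom_code (\<lambda>m. g (h m)) n" for n
    by (auto simp: rename_atom_code_def rename_term_code_comp list_encode_eq
        simp del: list_encode.simps split: list.split)
  then show ?thesis
    by (auto simp: rename_literal_code_def list_encode_eq simp del: list_encode.simps
        split: list.split)
qed

lemma rename_term_code_id: "rename_term_code (\<lambda>m. m) n = n"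
proof (induction n rule: less_induct)
  case (less n)
  have id: "map (rename_term_code (\<lambda>m. m)) ys = ys" if "list_decode n = a # b # ys" for a b ys
    using that less less_if_in_list_decode[of _ n] by (auto intro!: map_idI)
  have n: "n = list_encode xs" if "list_decode n = xs" for xs
    using list_decode_inverse[of n] that by simp
  show ?case
    by (subst rename_term_code.simps)
      (auto simp: id simp del: list_encode.simps dest: n[symmetric] split: list.split)
qed

lemma rename_literal_code_id: "rename_literal_code (\<lambda>m. m) n = n"
proof -
  have n: "list_encode xs = n" if "list_decode n = xs" for xs n
    using list_decode_inverse[of n] that by simp
  have T: "rename_term_code (\<lambda>m. m) = (\<lambda>n. n)"
    using rename_term_code_id by blast
  have "rename_atom_code (\<lambda>m. m) n = n" for n
    by (auto simp: rename_atom_code_def T simp del: list_encode.simps dest: n split: list.split)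
  then have A: "rename_atom_code (\<lambda>m. m) = (\<lambda>n. n)"
    by blast
  show ?thesis
    by (auto simp: rename_literal_code_def A simp del: list_encode.simps dest: n split: list.split)
qed

text \<open>Truth of literals transfers along \<open>h\<close>. If only the renamed number is known
  to code a literal, renaming back by \<open>inv h\<close> shows that \<open>x\<close> codes one
  too.\<close>

lemma atomic_diagram_rename:
  assumes "isomorphism L B A h"
  shows "rename_literal_code h x \<in> atomic_diagram L A \<longleftrightarrow> x \<in> atomic_diagram L B"
proof
  assume "x \<in> atomic_diagram L B"
  then obtain l where l: "x = literal_code l" "wf_literal L l" "literal_true B l"
    by (auto simp: atomic_diagram_def)
  then show "rename_literal_code h x \<in> atomic_diagram L A"
    using literal_true_rename[OF assms] by (auto simp: atomic_diagram_def rename_literal_code)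
next
  assume "rename_literal_code h x \<in> atomic_diagram L A"
  then obtain l where l: "rename_literal_code h x = literal_code l" "wf_literal L l" "literal_true A l"
    by (auto simp: atomic_diagram_def)
  have "bij h" using assms by (simp add: isomorphism_def)
  then have inv: "inv h (h m) = m" "h (inv h m) = m" for m
    by (simp_all add: bij_is_inj bij_inv_eq_iff bij_is_surj surj_f_inv_f)
  have "x = rename_literal_code (inv h) (literal_code l)"
    by (simp add: rename_literal_code_comp rename_literal_code_id inv flip: l(1))
  then have x: "x = literal_code (rename_literal (inv h) l)" by (simp add: rename_literal_code)
  have "literal_code (rename_literal h (rename_literal (inv h) l)) = literal_code l"
    using l(1) x by (simp add: rename_literal_code)
  then have "rename_literal h (rename_literal (inv h) l) = l" by (simp add: literal_code_inject)
  then have "literal_true B (rename_literal (inv h) l)"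
    using literal_true_rename[OF assms, of "rename_literal (inv h) l"] l by simp
  then show "x \<in> atomic_diagram L B"
    using x l(2) by (auto simp: atomic_diagram_def)
qed

lemma rec_in_rename_literal_code:
  assumes h: "rec_in X (\<lambda>p. h (fst p) (snd p))"
  shows "rec_in X (\<lambda>p. rename_literal_code (h (fst p)) (snd p))"
proof -
  \<comment> \<open>The table \<open>T\<close> holds the values at smaller arguments in descending
    order, which explains the position \<open>n - Suc y\<close>. The default 0 is never reached, as
    each entry \<open>y\<close> of the decoded list is below \<open>n\<close>.\<close>
  define H where "H a n T = (case list_decode n of [] \<Rightarrow> n | c # xs \<Rightarrow> (case xs of [] \<Rightarrow> n | b # ys \<Rightarrow>
    if c = 0 then list_encode (c # h a b # ys)
    else list_encode (c # b # map (\<lambda>y. case lookup T (n - Suc y) of None \<Rightarrow> 0 | Some z \<Rightarrow> z) ys)))"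
    for a n T
  have "rename_term_code (h a) n = H a n (map (rename_term_code (h a)) (rev [0..<n]))" for a n
  proof -
    have "lookup (map F (rev [0..<n])) (n - Suc y) = Some (F y)" if "y < n" for y and F :: "nat \<Rightarrow> nat"
      using that by (simp add: lookup_eq rev_nth)
    then show ?thesis
      using less_if_in_list_decode[of _ n]
      unfolding H_def rename_term_code.simps[of _ n]
      by (auto simp: list_encode_eq simp del: list_encode.simps split: list.split)
  qed
  moreover have "rec_in X (\<lambda>p. H (fst p) (fst (snd p)) (snd (snd p)))"
    unfolding H_def by (intro rec_intros rec_in_comp2[OF h])
  ultimately have T: "rec_in X (\<lambda>p. rename_term_code (h (fst p)) (snd p))"
    by (rule rec_in_course_of_values)
  have A: "rec_in X (\<lambda>p. rename_atom_code (h (fst p)) (snd p))"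
    unfolding rename_atom_code_def by (intro rec_intros rec_in_comp2[OF T])
  show ?thesis
    unfolding rename_literal_code_def by (intro rec_intros rec_in_comp2[OF A])
qed

section \<open>Finite approximations of a generic copy\<close>

text \<open>
  Codes exceed the elements that they mention, so \<open>x < length q\<close> guarantees that \<open>q\<close> is defined on
  all elements that occur in the literal with code \<open>x div 2\<close>.
\<close>

definition oracle_approx :: "nat set \<Rightarrow> nat list \<Rightarrow> bool list \<Rightarrow> nat \<Rightarrow> bool option" where
  "oracle_approx D q \<tau> x = (if x < length q \<and> x < length \<tau> then Some (if even x
      then rename_literal_code (\<lambda>m. case lookup q m of None \<Rightarrow> 0 | Some y \<Rightarrow> y) (x div 2) \<in> D
      else (case lookup \<tau> (x div 2) of None \<Rightarrow> False | Some b \<Rightarrow> b))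
    else None)"

text \<open>\<open>length q\<close> doubles as the search bound, so lengthening \<open>q\<close> and
  \<tau> eventually captures every halting computation.\<close>

definition eval_approx :: "nat set \<Rightarrow> prog \<Rightarrow> nat list \<Rightarrow> bool list \<Rightarrow> nat \<Rightarrow> nat option" where
  "eval_approx D e q \<tau> n = bounded_eval (oracle_approx D q \<tau>) (length q) e [n]"

lemma rec_in_eval_approx [rec_intros]:
  assumes D: "rec_in X (\<lambda>x. x \<in> D)" and "rec_in X q" "rec_in X \<tau>" "rec_in X n"
  shows "rec_in X (\<lambda>a. eval_approx D e (q a) (\<tau> a) (n a))"
proof -
  have "rec_in X (\<lambda>p. case lookup (fst p) (snd p) of None \<Rightarrow> 0 | Some y \<Rightarrow> (y :: nat))"
    by (intro rec_intros)
  note N = rec_in_rename_literal_code[OF this]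
  have "rec_in X (\<lambda>p. oracle_approx D (fst (fst p)) (snd (fst p)) (snd p))"
    unfolding oracle_approx_def by (intro rec_intros rec_in_comp[OF D] rec_in_comp2[OF N])
  from rec_in_bounded_eval[OF this, of "\<lambda>c. length (fst c)" e]
  have "rec_in X (\<lambda>p. bounded_eval (oracle_approx D (fst (fst p)) (snd (fst p)))
      (length (fst (fst p))) e (snd p))"
    by (simp add: rec_intros)
  from rec_in_comp[OF this rec_in_Pair[OF rec_in_Pair[OF assms(2,3)]
        rec_in_Cons[OF assms(4) rec_in_const]], of "[]"]
  show ?thesis by (simp add: eval_approx_def)
qed

definition approximates :: "nat list \<Rightarrow> (nat \<Rightarrow> nat) \<Rightarrow> bool" where
  "approximates q g \<longleftrightarrow> (\<forall>i < length q. q ! i = g i)"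

lemma oracle_approx_correct:
  assumes "isomorphism L G A g" "approximates q g" "initial_segment \<tau> X"
    "x < length q" "x < length \<tau>"
  shows "oracle_approx (atomic_diagram L A) q \<tau> x =
    Some (x \<in> turing_join (atomic_diagram L G) X)"
proof (cases "even x")
  case True
  then obtain m where m: "x = 2 * m" by blast
  \<comment> \<open>Here \<open>m \<le> x < length q\<close>, so \<open>q\<close> agrees with
    \<open>g\<close> on all numbers below \<open>m\<close>.\<close>
  have "rename_literal_code (\<lambda>m. case lookup q m of None \<Rightarrow> 0 | Some y \<Rightarrow> y) m = rename_literal_code g m"
    using assms(2,4) m by (intro rename_literal_code_cong) (simp add: lookup_eq approximates_def)
  with m show ?thesis
    using assms(4,5) atomic_diagram_rename[OF assms(1)] by (simp add: oracle_approx_def turing_join_iff)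
next
  case False
  then obtain m where m: "x = Suc (2 * m)" by (auto elim: oddE)
  then show ?thesis
    using assms(3-5) by (simp add: oracle_approx_def turing_join_iff lookup_eq initial_segment_def)
qed

lemma eval_approx_sound:
  assumes "isomorphism L G A g" "approximates q g" "initial_segment \<tau> X"
    "eval_approx (atomic_diagram L A) e q \<tau> n = Some y"
  shows "yields (turing_join (atomic_diagram L G) X) e [n] y"
proof -
  have "b \<longleftrightarrow> x \<in> turing_join (atomic_diagram L G) X"
    if "oracle_approx (atomic_diagram L A) q \<tau> x = Some b" for x b
    using that oracle_approx_correct[OF assms(1-3), of x]
    by (cases "x < length q \<and> x < length \<tau>") (auto simp: oracle_approx_def)
  then show ?thesis using assms(4) bounded_eval_sound unfolding eval_approx_def by blast
qed

lemma eval_approx_complete: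
  assumes "isomorphism L G A g" "yields (turing_join (atomic_diagram L G) X) e [n] y"
  shows "\<exists>k. \<forall>q \<tau>. approximates q g \<longrightarrow> initial_segment \<tau> X \<longrightarrow> k \<le> length q \<longrightarrow> k \<le> length \<tau> \<longrightarrow>
    eval_approx (atomic_diagram L A) e q \<tau> n = Some y"
proof -
  obtain k where k: "\<And>Q t. k \<le> t \<Longrightarrow> answers k (turing_join (atomic_diagram L G) X) Q \<Longrightarrow>
      bounded_eval Q t e [n] = Some y"
    using bounded_eval_complete[OF assms(2)] by blast
  show ?thesis
    unfolding eval_approx_def
    by (intro exI[of _ k] allI impI k) (auto simp: answers_def oracle_approx_correct[OF assms(1)])
qed

text \<open>Both sides see the same oracle: renaming by \<open>u\<close> and then by
  \<open>f\<close> is renaming by \<open>map f u\<close>, and \<open>f\<close> respects the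
  diagrams. Computations over \<open>A\<close> can thus be run over \<open>B\<close> without knowing
  \<open>f\<close>.\<close>

lemma eval_approx_map:
  assumes "isomorphism L B A f"
  shows "eval_approx (atomic_diagram L A) e (map f u) \<tau> n = eval_approx (atomic_diagram L B) e u \<tau> n"
proof -
  have "rename_literal_code (\<lambda>m. case lookup (map f u) m of None \<Rightarrow> 0 | Some y \<Rightarrow> y) m \<in> atomic_diagram L A \<longleftrightarrow>
      rename_literal_code (\<lambda>m. case lookup u m of None \<Rightarrow> 0 | Some y \<Rightarrow> y) m \<in> atomic_diagram L B"
    if "m < length u" for m
  proof -
    \<comment> \<open>Beyond \<open>length u\<close> the two renamings may differ, \<open>0\<close>
      against \<open>f 0\<close>, but only values below \<open>m\<close> matter.\<close>
    have "rename_literal_code (\<lambda>m. case lookup (map f u) m of None \<Rightarrow> 0 | Some y \<Rightarrow> y) m =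
        rename_literal_code f (rename_literal_code (\<lambda>m. case lookup u m of None \<Rightarrow> 0 | Some y \<Rightarrow> y) m)"
      unfolding rename_literal_code_comp
      using that by (intro rename_literal_code_cong) (simp add: lookup_eq)
    then show ?thesis by (simp add: atomic_diagram_rename[OF assms])
  qed
  then have "oracle_approx (atomic_diagram L A) (map f u) \<tau> = oracle_approx (atomic_diagram L B) u \<tau>"
    by (auto simp: oracle_approx_def fun_eq_iff)
  then show ?thesis by (simp add: eval_approx_def)
qed

section \<open>Forcing a program to fail\<close>

text \<open>Here \<tau> ranges over all extensions of \<sigma>, not just initial segments of the
  generic set; this is what later allows a search without that set.\<close>

definition never_wrong :: "nat set \<Rightarrow> prog \<Rightarrow> nat list \<Rightarrow> bool list \<Rightarrow> bool" where
  "never_wrong D e p \<sigma> \<longleftrightarrow> (\<forall>q \<tau> n y. prefix p q \<longrightarrow> distinct q \<longrightarrow> prefix \<sigma> \<tau> \<longrightarrow> n < length q \<longrightarrow>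
    eval_approx D e q \<tau> n = Some y \<longrightarrow> y = q ! n)"

text \<open>The witnesses \<tau> come from \<open>X\<close> itself, so the negation provides
  \<open>q\<close> and \<open>n\<close> such that no extension of \<open>q\<close> converges at
  \<open>n\<close> along initial segments of \<open>X\<close> extending \<sigma>.\<close>

definition always_extendible :: "nat set \<Rightarrow> nat set \<Rightarrow> prog \<Rightarrow> nat list \<Rightarrow> bool list \<Rightarrow> bool" where
  "always_extendible D X e p \<sigma> \<longleftrightarrow> (\<forall>q n. prefix p q \<longrightarrow> distinct q \<longrightarrow>
    (\<exists>r \<tau>. prefix q r \<and> distinct r \<and> prefix \<sigma> \<tau> \<and> initial_segment \<tau> X \<and> eval_approx D e r \<tau> n \<noteq> None))"

text \<open>For fixed \<open>p\<close> and decidable \<open>D\<close> an error is a finite,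
  checkable event, so the set is the projection of a decidable relation.\<close>

lemma ce_strings_wrong:
  assumes "decidable D"
  shows "ce_strings {\<tau>. \<exists>q n y. prefix p q \<and> distinct q \<and> n < length q \<and>
    eval_approx D e q \<tau> n = Some y \<and> y \<noteq> q ! n}" (is "ce_strings ?W")
proof -
  \<comment> \<open>Every number is read as a string, nonzero entries being true; the first conjunct
    of \<open>P\<close> discards numbers that are not string codes.\<close>
  define S where "S a = map (\<lambda>i. i \<noteq> 0) (list_decode a)" for a :: nat
  \<comment> \<open>The witness \<open>z\<close> codes a pair of a suffix to be appended to
    \<open>p\<close> and the input at which the error occurs.\<close>
  define U where "U z = p @ list_decode (fst (prod_decode z))" for z
  define P where "P a z \<longleftrightarrow> list_encode (map (\<lambda>b. if b then 1 else 0) (S a)) = a \<and> distinct (U z) \<and>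
    (case lookup (U z) (snd (prod_decode z)) of None \<Rightarrow> False | Some w \<Rightarrow>
      (case eval_approx D e (U z) (S a) (snd (prod_decode z)) of None \<Rightarrow> False | Some y \<Rightarrow> y \<noteq> w))" for a z
  have of_bool: "(of_bool :: bool \<Rightarrow> nat) = (\<lambda>b. if b then 1 else 0)"
    by (simp add: fun_eq_iff)
  have "rec_in {} (\<lambda>x. x \<in> D)"
    using assms by (simp add: rec_in_member_iff decidable_def)
  then have "rec_in {} (\<lambda>c. P (fst c) (snd c))"
    unfolding P_def S_def U_def by (intro rec_intros)
  then have "ce {a. \<exists>z. P a z}" by (rule ce_ex)
  moreover have "{a. \<exists>z. P a z} = string_code ` ?W"
  proof (intro equalityI subsetI)
    fix a assume "a \<in> {a. \<exists>z. P a z}"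
    then obtain z where z: "P a z" by blast
    then have a: "string_code (S a) = a" by (simp add: P_def string_code_def of_bool)
    obtain y where "eval_approx D e (U z) (S a) (snd (prod_decode z)) = Some y"
      "y \<noteq> U z ! snd (prod_decode z)" "snd (prod_decode z) < length (U z)" "distinct (U z)"
      using z by (auto simp: P_def lookup_eq split: option.split_asm if_splits)
    moreover have "prefix p (U z)" by (simp add: U_def)
    ultimately have "S a \<in> ?W" by (intro CollectI exI conjI)
    then show "a \<in> string_code ` ?W" by (rule image_eqI[where f = string_code, OF a[symmetric]])
  next
    fix a assume "a \<in> string_code ` ?W"
    then obtain \<tau> v n y where *: "a = string_code \<tau>" "distinct (p @ v)" "n < length (p @ v)"
      "eval_approx D e (p @ v) \<tau> n = Some y" "y \<noteq> (p @ v) ! n"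
      by (auto elim!: prefixE)
    have "S a = \<tau>" by (simp add: S_def *(1) string_code_def o_def)
    then have "P a (prod_encode (list_encode v, n))"
      using * by (simp add: P_def U_def lookup_eq string_code_def of_bool)
    then show "a \<in> {a. \<exists>z. P a z}" by blast
  qed
  ultimately show ?thesis by (simp add: ce_strings_def)
qed

lemma ex_longer_initial_segment:
  assumes "initial_segment \<sigma> X"
  shows "\<exists>\<tau>. prefix \<sigma> \<tau> \<and> initial_segment \<tau> X \<and> k \<le> length \<tau>"
proof (intro exI conjI)
  let ?\<tau> = "map (\<lambda>i. i \<in> X) [0..<length \<sigma> + k]"
  have "\<sigma> = map (\<lambda>i. i \<in> X) [0..<length \<sigma>]"
    using assms by (auto simp: initial_segment_def intro: nth_equalityI)
  then have "?\<tau> = \<sigma> @ map (\<lambda>i. i \<in> X) [length \<sigma>..<length \<sigma> + k]"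
    by (metis map_append upt_add_eq_append zero_le)
  then show "prefix \<sigma> ?\<tau>" by (metis prefixI)
qed (auto simp: initial_segment_def)

lemma ex_longer_approximation:
  assumes "approximates q g" "inj g"
  shows "\<exists>r. prefix q r \<and> distinct r \<and> approximates r g \<and> k \<le> length r"
proof (intro exI conjI)
  let ?r = "map g [0..<length q + k]"
  have "q = map g [0..<length q]"
    using assms by (auto simp: approximates_def intro: nth_equalityI)
  then have "?r = q @ map g [length q..<length q + k]"
    by (metis map_append upt_add_eq_append zero_le)
  then show "prefix q ?r" by (metis prefixI)
  show "distinct ?r" using assms(2) by (simp add: distinct_map inj_on_def inj_def)
qed (auto simp: approximates_def)

text \<open>Genericity is applied to the strings that admit an error. Meeting this set gives a
  \<open>q\<close> with a wrong value; avoiding it gives \<open>never_wrong\<close>, and then the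
  failure of \<open>always_extendible\<close> gives a \<open>q\<close> beyond which \<open>e\<close>
  diverges.\<close>

lemma ex_diagonalizing_extension:
  assumes X: "one_generic X" and D: "decidable (atomic_diagram L A)" and p: "distinct p"
    and no: "\<And>\<sigma>. initial_segment \<sigma> X \<Longrightarrow> never_wrong (atomic_diagram L A) e p \<sigma> \<Longrightarrow>
      \<not> always_extendible (atomic_diagram L A) X e p \<sigma>"
  shows "\<exists>q. prefix p q \<and> distinct q \<and> (\<forall>G g. isomorphism L G A g \<longrightarrow> approximates q g \<longrightarrow>
    \<not> (\<forall>n. yields (turing_join (atomic_diagram L G) X) e [n] (g n)))"
proof -
  let ?D = "atomic_diagram L A"
  let ?W = "{\<tau>. \<exists>q n y. prefix p q \<and> distinct q \<and> n < length q \<and>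
    eval_approx ?D e q \<tau> n = Some y \<and> y \<noteq> q ! n}"
  obtain \<sigma> where \<sigma>: "initial_segment \<sigma> X" "\<sigma> \<in> ?W \<or> (\<forall>\<tau>. prefix \<sigma> \<tau> \<longrightarrow> \<tau> \<notin> ?W)"
    using X ce_strings_wrong[OF D] unfolding one_generic_def by blast
  show ?thesis
  proof (cases "\<sigma> \<in> ?W")
    case True
    then obtain q n y where q: "prefix p q" "distinct q" "n < length q"
      "eval_approx ?D e q \<sigma> n = Some y" "y \<noteq> q ! n" by blast
    have "\<not> yields (turing_join (atomic_diagram L G) X) e [n] (g n)"
      if "isomorphism L G A g" "approximates q g" for G g
      using eval_approx_sound[OF that \<sigma>(1) q(4)] q(3,5) that(2)
      by (metis approximates_def yields_deterministic)
    with q show ?thesis by blast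
  next
    case False
    with \<sigma> have "never_wrong ?D e p \<sigma>" unfolding never_wrong_def by blast
    with no \<sigma>(1) obtain q n where q: "prefix p q" "distinct q"
      "\<And>r \<tau>. prefix q r \<Longrightarrow> distinct r \<Longrightarrow> prefix \<sigma> \<tau> \<Longrightarrow> initial_segment \<tau> X \<Longrightarrow> eval_approx ?D e r \<tau> n = None"
      unfolding always_extendible_def by blast
    have "\<not> yields (turing_join (atomic_diagram L G) X) e [n] (g n)"
      if g: "isomorphism L G A g" "approximates q g" for G g
    proof
      \<comment> \<open>Sufficiently long pieces of \<open>g\<close> and \<open>X\<close> would
        reproduce this computation and thus extend \<open>q\<close> to a convergent one.\<close>
      assume "yields (turing_join (atomic_diagram L G) X) e [n] (g n)"
      then obtain k where k: "\<And>r \<tau>. approximates r g \<Longrightarrow> initial_segment \<tau> X \<Longrightarrow> k \<le> length r \<Longrightarrow>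
          k \<le> length \<tau> \<Longrightarrow> eval_approx ?D e r \<tau> n = Some (g n)"
        using eval_approx_complete[OF g(1)] by blast
      have "inj g" using g(1) by (simp add: isomorphism_def bij_is_inj)
      then obtain r where r: "prefix q r" "distinct r" "approximates r g" "k \<le> length r"
        using ex_longer_approximation g(2) by blast
      obtain \<tau> where "prefix \<sigma> \<tau>" "initial_segment \<tau> X" "k \<le> length \<tau>"
        using ex_longer_initial_segment \<sigma>(1) by blast
      with r k q(3) show False by fastforce
    qed
    with q show ?thesis by blast
  qed
qed

section \<open>Construction of a generic copy\<close>

text \<open>A finite extension argument: stage \<open>k\<close> meets the requirement numbered
  \<open>k\<close> and then puts \<open>k\<close> into the range if it is missing.\<close>

lemma ex_generic_bijection:
  fixes R :: "'e::countable \<Rightarrow> nat list \<Rightarrow> bool"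
  assumes "\<And>e p. distinct p \<Longrightarrow> \<exists>q. prefix p q \<and> distinct q \<and> R e q"
  shows "\<exists>g. bij g \<and> (\<forall>e. \<exists>q. approximates q g \<and> R e q)"
proof -
  define ext where "ext e p = (SOME q. prefix p q \<and> distinct q \<and> R e q)" for e p
  have ext: "prefix p (ext e p)" "distinct (ext e p)" "R e (ext e p)" if "distinct p" for e p
    using someI_ex[OF assms[OF that, of e]] by (simp_all add: ext_def)
  define step where
    "step k p = ext (from_nat k) p @ (if k \<in> set (ext (from_nat k) p) then [] else [k])" for k p
  define P where "P = rec_nat [] step"
  have P_Suc: "P (Suc k) = step k (P k)" for k by (simp add: P_def)
  have dist: "distinct (P k)" for k
  proof (induction k)
    case (Suc k)
    then show ?case by (simp add: P_Suc step_def ext)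
  qed (simp add: P_def)
  have step: "prefix (P k) (P (Suc k))" for k
    using ext(1)[OF dist] by (simp add: P_Suc step_def prefix_prefix)
  have mono: "prefix (P j) (P k)" if "j \<le> k" for j k
    using that by (induction rule: dec_induct) (auto intro: prefix_order.trans step)
  have in_P: "j \<in> set (P k)" if "j < k" for j k
  proof -
    have "j \<in> set (P (Suc j))" by (simp add: P_Suc step_def)
    then show ?thesis using mono[of "Suc j" k] that set_mono_prefix by fastforce
  qed
  \<comment> \<open>The numbers below \<open>k\<close> all occur in \<open>P k\<close>, which forces
    its length. Hence the limit is defined everywhere, and \<open>P (Suc i)\<close> already has an
    entry at \<open>i\<close>.\<close>
  have len: "k \<le> length (P k)" for k
  proof -
    have "card {..<k} \<le> card (set (P k))" using in_P by (intro card_mono) auto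
    then show ?thesis using dist by (simp add: distinct_card)
  qed
  define g where "g i = P (Suc i) ! i" for i
  have agree: "P k ! i = g i" if "i < length (P k)" for i k
  proof -
    \<comment> \<open>Both stages are compared with a common later one.\<close>
    have nth: "P j ! i = P (max k (Suc i)) ! i" if "j \<le> max k (Suc i)" "i < length (P j)" for j
      using mono[OF that(1)] that(2) by (auto simp: prefix_def nth_append)
    show ?thesis
      unfolding g_def using nth[of k] nth[of "Suc i"] that len[of "Suc i"] by simp
  qed
  have "inj g"
  proof (rule injI)
    fix i j assume "g i = g j"
    moreover have "i < length (P (Suc (max i j)))" "j < length (P (Suc (max i j)))"
      using len[of "Suc (max i j)"] by auto
    ultimately show "i = j" using dist agree nth_eq_iff_index_eq by metis
  qed
  moreover have "surj g"
    unfolding surj_def using in_P[of _ "Suc _"] agree by (metis in_set_conv_nth lessI)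
  moreover have "\<exists>q. approximates q g \<and> R e q" for e
  proof (intro exI conjI)
    let ?k = "to_nat e"
    show "R e (ext e (P ?k))" using ext(3) dist .
    have "prefix (ext e (P ?k)) (P (Suc ?k))" by (simp add: P_Suc step_def)
    then obtain zs where zs: "P (Suc ?k) = ext e (P ?k) @ zs" by (auto simp: prefix_def)
    show "approximates (ext e (P ?k)) g"
      unfolding approximates_def
    proof (intro allI impI)
      fix i assume "i < length (ext e (P ?k))"
      then show "ext e (P ?k) ! i = g i" using agree[of i "Suc ?k"] by (simp add: zs nth_append)
    qed
  qed
  ultimately show ?thesis by (auto simp: bij_def)
qed

text \<open>There is one requirement for each program, so these can be enumerated in stages.\<close>

instance prog :: countable
  by countable_datatype

lemma ex_pullback:
  assumes "bij g"
  shows "\<exists>G. isomorphism L G A g"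
proof
  show "isomorphism L \<lparr>rel_interp = \<lambda>r xs. rel_interp A r (map g xs),
      fun_interp = \<lambda>f xs. inv g (fun_interp A f (map g xs))\<rparr> A g"
    using assms by (simp add: isomorphism_def bij_is_surj surj_f_inv_f)
qed

text \<open>Composing \<open>f\<close> with the inverse of \<open>g\<close> gives an automorphism of
  \<open>A\<close>. By uniqueness, diagonalizing against one isomorphism defeats all of
  them.\<close>

lemma rigid_isomorphism_unique:
  assumes "rigid L A" "isomorphism L B A f" "isomorphism L B A g"
  shows "f = g"
proof -
  have bij: "bij f" "bij g" using assms by (simp_all add: isomorphism_def)
  have g: "g (inv g x) = x" "inv g (g x) = x" for x
    using bij(2) by (simp_all add: bij_is_inj bij_is_surj surj_f_inv_f)
  have map: "map g (map (inv g) xs) = xs" for xs :: "nat list" by (simp add: o_def g)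
  have "isomorphism L A A (f \<circ> inv g)"
    unfolding isomorphism_def
  proof (intro conjI ballI allI impI)
    show "bij (f \<circ> inv g)" using bij by (simp add: bij_comp bij_imp_bij_inv)
  next
    fix r and xs :: "nat list" assume "r \<in> rel_symbols L" "length xs = rel_arity L r"
    then have "rel_interp B r (map (inv g) xs) \<longleftrightarrow> rel_interp A r (map f (map (inv g) xs))"
      "rel_interp B r (map (inv g) xs) \<longleftrightarrow> rel_interp A r (map g (map (inv g) xs))"
      using assms(2,3) by (simp_all add: isomorphism_def del: map_map)
    then show "rel_interp A r xs \<longleftrightarrow> rel_interp A r (map (f \<circ> inv g) xs)"
      by (simp add: map del: map_map) simp
  next
    fix s and xs :: "nat list" assume "s \<in> fun_symbols L" "length xs = fun_arity L s"
    then have "f (fun_interp B s (map (inv g) xs)) = fun_interp A s (map f (map (inv g) xs))"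
      "g (fun_interp B s (map (inv g) xs)) = fun_interp A s (map g (map (inv g) xs))"
      using assms(2,3) by (simp_all add: isomorphism_def del: map_map)
    then show "(f \<circ> inv g) (fun_interp A s xs) = fun_interp A s (map (f \<circ> inv g) xs)"
      using g(2)[of "fun_interp B s (map (inv g) xs)"] by (simp add: map del: map_map) simp
  qed
  then have "f \<circ> inv g = id" using assms(1) by (simp add: rigid_def)
  then show ?thesis using g(2) by (metis comp_apply id_apply ext)
qed

lemma ex_forcing_condition:
  assumes "one_generic X" "decidable (atomic_diagram L A)" "rigid L A"
    and "relatively_categorical (degree X) L A"
  shows "\<exists>e p \<sigma>. distinct p \<and> initial_segment \<sigma> X \<and> never_wrong (atomic_diagram L A) e p \<sigma> \<and>
    always_extendible (atomic_diagram L A) X e p \<sigma>"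
proof (rule ccontr)
  assume no: "\<not> ?thesis"
  have "\<exists>q. prefix p q \<and> distinct q \<and> (\<forall>G g. isomorphism L G A g \<longrightarrow> approximates q g \<longrightarrow>
      \<not> (\<forall>n. yields (turing_join (atomic_diagram L G) X) e [n] (g n)))" if "distinct p" for e p
    using that no by (intro ex_diagonalizing_extension assms(1,2)) blast+
  from ex_generic_bijection[of "\<lambda>e q. \<forall>G g. isomorphism L G A g \<longrightarrow> approximates q g \<longrightarrow>
      \<not> (\<forall>n. yields (turing_join (atomic_diagram L G) X) e [n] (g n))", OF this]
  obtain g where "bij g" and g: "\<And>G e. isomorphism L G A g \<Longrightarrow>
      \<not> (\<forall>n. yields (turing_join (atomic_diagram L G) X) e [n] (g n))"
    by blast
  obtain G where G: "isomorphism L G A g" using ex_pullback[OF \<open>bij g\<close>] by blast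
  then obtain h where h: "isomorphism L G A h"
    "degree_computes (sup (model_degree L G) (degree X)) h"
    using assms(4) unfolding relatively_categorical_def isomorphic_def by blast
  \<comment> \<open>Categoricity promises just some isomorphism; rigidity identifies it with the one
    diagonalized against.\<close>
  have "h = g" by (rule rigid_isomorphism_unique[OF assms(3) h(1) G])
  with h(2) have "computable_from (turing_join (atomic_diagram L G) X) g"
    by (simp add: model_degree_def sup_turing_degree.abs_eq degree_computes.abs_eq)
  then show False using g[OF G] unfolding computable_from_def by blast
qed

section \<open>Computing an isomorphism by search\<close>

lemma isomorphism_computable:
  assumes p: "distinct p" and wrong: "never_wrong (atomic_diagram L A) e p \<sigma>"
    and extend: "always_extendible (atomic_diagram L A) X e p \<sigma>" and f: "isomorphism L B A f"
  shows "rec_in (atomic_diagram L B) f"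
proof -
  let ?B = "atomic_diagram L B"
  have "bij f" using f by (simp add: isomorphism_def)
  then have inv: "f (inv f x) = x" "inv f (f x) = x" for x
    by (simp_all add: bij_is_inj bij_is_surj surj_f_inv_f)
  have map_inv: "map f (map (inv f) xs) = xs" for xs by (simp add: o_def inv)
  have inj: "inj_on f S" "inj_on (inv f) S" for S
    using inv by (metis inj_on_inverseI)+
  \<comment> \<open>A number \<open>z\<close> codes a suffix for the pulled back \<open>p\<close>, a
    suffix for \<sigma> and an input. The list \<open>map (inv f) p\<close> is finite and enters the
    program as a constant, so no access to \<open>f\<close> is required.\<close>
  define U where "U z = map (inv f) p @ list_decode (fst (prod_decode z))" for z
  define T where "T z = \<sigma> @ map (\<lambda>i. i \<noteq> 0) (list_decode (fst (prod_decode (snd (prod_decode z)))))" for z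
  define N where "N z = snd (prod_decode (snd (prod_decode z)))" for z
  define V where "V z = eval_approx ?B e (U z) (T z) (N z)" for z
  \<comment> \<open>The search succeeds when \<open>b\<close> sits at the input position and the
    computation converges; \<open>f\<close> and \<open>X\<close> do not occur in this test.\<close>
  define P where "P b z \<longleftrightarrow> distinct (U z) \<and>
    (case lookup (U z) (N z) of None \<Rightarrow> False | Some c \<Rightarrow> c = b) \<and>
    (case V z of None \<Rightarrow> False | Some _ \<Rightarrow> True)" for b z
  \<comment> \<open>Carried to \<open>A\<close> along \<open>f\<close>, the computation uses an
    extension of \<open>p\<close>, so \<open>never_wrong\<close> makes its output the entry
    \<open>f b\<close>.\<close>
  have correct: "V z = Some (f b)" if Pz: "P b z" for b z
  proof -
    have u: "distinct (U z)" "N z < length (U z)" "U z ! N z = b"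
      using Pz by (auto simp: P_def lookup_eq split: if_splits)
    obtain y where y: "V z = Some y" using Pz by (auto simp: P_def split: option.split_asm)
    then have "eval_approx (atomic_diagram L A) e (map f (U z)) (T z) (N z) = Some y"
      by (simp add: V_def eval_approx_map[OF f])
    moreover have "prefix p (map f (U z))"
      using map_inv[of p] by (simp add: U_def del: map_map)
    moreover have "distinct (map f (U z))" using u(1) inj by (simp add: distinct_map)
    moreover have "prefix \<sigma> (T z)" by (simp add: T_def)
    ultimately have "y = map f (U z) ! N z"
      using wrong u(2) unfolding never_wrong_def by (metis length_map)
    then show ?thesis using y u by simp
  qed
  have total: "\<exists>z. P b z" for b
  proof -
    obtain q n where q: "prefix p q" "distinct q" "n < length q" "q ! n = f b"
    \<comment> \<open>To have \<open>f b\<close> in the range, \<open>p\<close> itself suffices or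
      is lengthened by one entry.\<close>
    proof (cases "f b \<in> set p")
      case True
      then show ?thesis using that[of p] p by (auto simp: in_set_conv_nth)
    next
      case False
      then show ?thesis using that[of "p @ [f b]" "length p"] p by simp
    qed
    then obtain r \<tau> where r: "prefix q r" "distinct r" "prefix \<sigma> \<tau>"
      "eval_approx (atomic_diagram L A) e r \<tau> n \<noteq> None"
      using extend unfolding always_extendible_def by blast
    obtain v where v: "r = p @ v" using q(1) r(1) by (auto simp: prefix_def)
    obtain w where w: "\<tau> = \<sigma> @ w" using r(3) by (auto simp: prefix_def)
    \<comment> \<open>The convergent extension found over \<open>A\<close> is pulled back to
      \<open>B\<close>; bits are stored as 0 and 1, which \<open>T\<close> reads back.\<close>
    define z where "z = prod_encode (list_encode (map (inv f) v),
      prod_encode (list_encode (map of_bool w), n))"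
    have U: "U z = map (inv f) r" by (simp add: U_def z_def v)
    have T: "T z = \<tau>" by (simp add: T_def z_def w o_def)
    have N: "N z = n" by (simp add: N_def z_def)
    have n: "n < length r" "r ! n = f b" using q r(1) by (auto simp: prefix_def nth_append)
    have "V z \<noteq> None"
      using r(4) eval_approx_map[OF f, of e "U z" \<tau> n] by (simp add: V_def T N U map_inv del: map_map)
    then have "P b z"
      using r(2) n inj by (auto simp: P_def U N lookup_eq distinct_map inv)
    then show ?thesis by blast
  qed
  have "rec_in ?B (\<lambda>x. x \<in> ?B)" by (simp add: rec_in_member_iff turing_reducible_refl)
  then have V: "rec_in ?B V" unfolding V_def U_def T_def N_def by (intro rec_intros)
  have "rec_in ?B (\<lambda>c. P (fst c) (snd c))"
    unfolding P_def U_def N_def by (intro rec_intros rec_in_comp[OF V])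
  then have "rec_in ?B (\<lambda>b. V (LEAST z. P b z))"
    using total by (intro rec_in_comp[OF V] rec_in_Least)
  moreover have "V (LEAST z. P b z) = Some (f b)" for b
    using total by (metis correct LeastI)
  ultimately have "rec_in ?B (\<lambda>b. Some (f b))" by simp
  from rec_in_case_option[OF this, of "\<lambda>_. 0" "\<lambda>_ y. y"] show ?thesis
    by (simp add: rec_intros)
qed

theorem corollary1:
  fixes L :: language and A :: model
  assumes "computable_structure L A"
    and "rigid L A"
    and "\<exists>x. one_generic_degree x \<and> relatively_categorical x L A"
  shows "relatively_computably_categorical L A"
proof -
  obtain X where X: "one_generic X" "relatively_categorical (degree X) L A"
    using assms(3) unfolding one_generic_degree_def by blast
  have "decidable (atomic_diagram L A)" using assms(1) by (simp add: computable_structure_def)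
  then obtain e p \<sigma> where "distinct p" "never_wrong (atomic_diagram L A) e p \<sigma>"
    "always_extendible (atomic_diagram L A) X e p \<sigma>"
    using ex_forcing_condition[OF X(1) _ assms(2) X(2)] by blast
  then have "computable_from (atomic_diagram L B) f" if "isomorphism L B A f" for B f
    using isomorphism_computable that by (simp flip: rec_in_nat_iff)
  \<comment> \<open>Every isomorphism from \<open>B\<close> is computable from its diagram, and the
    join with \<open>bot\<close> does not change the degree.\<close>
  then show ?thesis
    unfolding relatively_computably_categorical_def relatively_categorical_def isomorphic_def
    by (auto simp: model_degree_def degree_computes.abs_eq)
qed

end
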